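(* Let $T_m$ be a tree on $m$ vertices and let $T'_m$ be obtained from $T_m$ by a KC-transformation. (i) If $n$ is even, or $n$ is odd and $\mathrm{diam}(T_m)\leq n-1$, then $$\hom(T_m,P_n)\leq \hom(T'_m,P_n).$$ (ii) For any $m,n$ (and any tree $T_m$ on $m$ vertices), $$\hom(P_m,P_n)\leq \hom(T_m,P_n)\leq \hom(S_m,P_n).$$
   Context: Graphs are finite, undirected, without loops and multiple edges; $m,n$ are positive integers. $\hom(H,G)$ denotes the number of homomorphisms from $H$ to $G$, i.e. maps $f:V(H)\to V(G)$ such that images of adjacent vertices are adjacent. $P_n$ and $S_n$ are the path and the star on $n$ vertices. $\mathrm{diam}(T)$ is the diameter, i.e. the maximal distance between two vertices of $T$. KC-transformation: let $x$ and $y$ be two (distinct) vertices of a tree $T$ such that every interior vertex of the unique $x$–$y$ path $P$ in $T$ has degree two in $T$, and let $z$ be the neighbor of $y$ on this path. Let $N(y)$ be the set of neighbors of $y$. The KC-transformation $KC(T,x,y)$ of $T$ with respect to the path $P$ is the tree obtained from $T$ by deleting all edges between $y$ and $N(y)\setminus\{z\}$ and adding the edges between $x$ and $N(y)\setminus\{z\}$ instead. A tree $T'$ is obtained from $T$ by a KC-transformation if $T'=KC(T,x,y)$ for some such $x,y$. *)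

theory Defs
  imports "Graph_Theory.Graph_Theory" "HOL-Library.FuncSet"
begin

text \<open>
  Finite simple graphs are modelled by the locale \<open>pair_graph\<close>: an undirected edge between
  \<open>u\<close> and \<open>v\<close> is the pair of arcs \<open>(u, v)\<close> and \<open>(v, u)\<close>.

  The predicate \<open>tree\<close> of \<open>Graph_Theory\<close> cannot be used here: it counts the closed walk
  \<open>u, v, u\<close> as a cycle, so a symmetric digraph with at least one edge is never a tree in
  that sense. Undirected cycles are exactly the library cycles of length at least three.
\<close>

definition undirected_tree :: "'a pair_pre_digraph \<Rightarrow> bool" where
  "undirected_tree T \<longleftrightarrow>
     pair_graph T \<and> Digraph_Component.connected (with_proj T) \<and>
     \<not> (\<exists>c. pre_digraph.cycle (with_proj T) c \<and> length c \<ge> 3)"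

definition graph_dist :: "'a pair_pre_digraph \<Rightarrow> 'a \<Rightarrow> 'a \<Rightarrow> ereal" where
  "graph_dist G u v = wf_digraph.\<mu> (with_proj G) (\<lambda>_. 1) u v"

definition diam :: "'a pair_pre_digraph \<Rightarrow> ereal" where
  "diam G = Max {graph_dist G u v | u v. u \<in> pverts G \<and> v \<in> pverts G}"

definition neighbors :: "'a pair_pre_digraph \<Rightarrow> 'a \<Rightarrow> 'a set" where
  "neighbors G v = {w. (v, w) \<in> parcs G}"

text \<open>
  Homomorphisms are extensional functions on the vertex set, so that each map
  \<open>V(H) \<rightarrow> V(G)\<close> is counted once.
\<close>

definition homs :: "'a pair_pre_digraph \<Rightarrow> 'b pair_pre_digraph \<Rightarrow> ('a \<Rightarrow> 'b) set" where
  "homs H G = {f \<in> pverts H \<rightarrow>\<^sub>E pverts G. \<forall>(u, v) \<in> parcs H. (f u, f v) \<in> parcs G}"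

definition hom :: "'a pair_pre_digraph \<Rightarrow> 'b pair_pre_digraph \<Rightarrow> nat" where
  "hom H G = card (homs H G)"

definition path_graph :: "nat \<Rightarrow> nat pair_pre_digraph" where
  "path_graph n =
     \<lparr> pverts = {..<n},
       parcs = {(i, j). i < n \<and> j < n \<and> (j = Suc i \<or> i = Suc j)} \<rparr>"

definition star_graph :: "nat \<Rightarrow> nat pair_pre_digraph" where
  "star_graph n =
     \<lparr> pverts = {..<n},
       parcs = {(i, j). i < n \<and> j < n \<and> (i = 0 \<and> j \<noteq> 0 \<or> i \<noteq> 0 \<and> j = 0)} \<rparr>"

text \<open>
  The path \<open>P\<close> from \<open>x\<close> to \<open>y\<close> is given by its list of arcs \<open>p\<close>; since \<open>x \<noteq> y\<close>, the list is
  nonempty, and its last arc is \<open>(z, y)\<close>. In a tree \<open>p\<close> is determined by \<open>x\<close> and \<open>y\<close>.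
\<close>

definition KC :: "'a pair_pre_digraph \<Rightarrow> 'a \<Rightarrow> ('a \<times> 'a) awalk \<Rightarrow> 'a \<Rightarrow> 'a pair_pre_digraph" where
  "KC T x p y =
     (let z = fst (last p); A = neighbors T y - {z} in
      \<lparr> pverts = pverts T,
        parcs = (parcs T - ({y} \<times> A \<union> A \<times> {y})) \<union> ({x} \<times> A \<union> A \<times> {x}) \<rparr>)"

definition KC_transformation :: "'a pair_pre_digraph \<Rightarrow> 'a pair_pre_digraph \<Rightarrow> bool" where
  "KC_transformation T T' \<longleftrightarrow>
     (\<exists>x y p. x \<noteq> y \<and> pre_digraph.apath (with_proj T) x p y \<and>
        (\<forall>v \<in> set (pre_digraph.awalk_verts (with_proj T) x p) - {x, y}.
           out_degree (with_proj T) v = 2) \<and>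
        T' = KC T x p y)"

end

theory Submission
  imports Defs
begin

text \<open>
  Write \<open>[n] = {0, ..., n - 1}\<close> for the vertices of the path \<open>P_n\<close> and \<open>A\<close> for its adjacency operator
  (\<open>nbr_sum\<close>). Give every vertex \<open>v\<close> of a tree a weight \<open>\<phi>\<^sub>v : [n] \<Rightarrow> \<real>\<close> and count homomorphisms \<open>h\<close> with
  the weight \<open>\<Prod>\<^sub>v \<phi>\<^sub>v (h v)\<close>. A leaf \<open>u\<close> hanging at \<open>v\<close> can then be removed: the count does not change if
  \<open>\<phi>\<^sub>v\<close> is replaced by \<open>\<phi>\<^sub>v \<cdot> A \<phi>\<^sub>u\<close> (\<open>weighted_hom_leaf\<close>). Repeating this prunes the tree to any chosen
  subtree, and the shape of the pruned branches survives only in the weights. The statement on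
  KC-transformations and the bound by the path rest on knowing which vectors occur as weights.

  KC-transformations. Pruning down to the path between \<open>x\<close> and \<open>y\<close>, of length \<open>k\<close>, leaves a weight \<open>a\<close> at \<open>x\<close>, a
  weight \<open>b\<close> at \<open>y\<close> and constant weights in between, so the tree has \<open>\<langle>a, A\<^sup>k b\<rangle>\<close> homomorphisms. In the
  transformed tree both weights sit at \<open>x\<close>, which gives \<open>\<langle>a b, A\<^sup>k 1\<rangle>\<close>. As \<open>A\<^sup>k\<close> is symmetric, twice the
  difference is the sum over \<open>i, j\<close> of \<open>(A\<^sup>k)\<^sub>i\<^sub>j (a i - a j) (b i - b j)\<close>, and it suffices that \<open>a\<close> and \<open>b\<close>
  order \<open>i\<close> and \<open>j\<close> in the same way whenever a walk of length \<open>k\<close> joins \<open>i\<close> and \<open>j\<close> (\<open>comonotone_dotp_le\<close>).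
  For even \<open>n\<close>, weights increase towards the centre of the path (\<open>central_cone\<close>), because this
  property is kept by products and by \<open>A\<close>. For odd \<open>n\<close> it holds only among positions of equal
  parity, so a different property is used: the weight of a branch of height \<open>h\<close> is symmetric and
  increases on \<open>0, ..., n - 1 - h\<close> (\<open>rising_cone\<close>). If both heights and \<open>k\<close> add up to at most
  \<open>n - 1\<close>, which is what the bound on the diameter says, then \<open>a\<close> and \<open>b\<close> are again ordered alike
  (\<open>rising_cone_comonotone\<close>).

  Stars. Adding a leaf at \<open>v\<close> doubles the number of homomorphisms, except that a homomorphism
  sending \<open>v\<close> to an end of the path is extended in one way only. Both ends are attained, as a
  2-colouring of the tree shows if \<open>n \<ge> 2\<close>. Hence \<open>hom(T, P_n) \<le> (n - 2) 2^(m-1) + 2\<close>, which is the value for the star.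

  Paths. Say that \<open>f\<close> outweighs \<open>g\<close> if \<open>\<langle>r, g\<rangle> \<le> \<langle>r, f\<rangle>\<close> for all \<open>r\<close> in the central cone. This relation is
  compatible with products and with \<open>A\<close>, and the inequality behind the KC-transformation says that
  \<open>A\<^sup>k 1 \<cdot> A\<^sup>l 1\<close> outweighs \<open>A\<^sup>k\<^sup>+\<^sup>l 1\<close>. For even \<open>n\<close> it follows that the weight of a branch with \<open>s\<close> vertices
  outweighs \<open>A\<^sup>s\<^sup>-\<^sup>1 1\<close>, and this is the lower bound. For odd \<open>n\<close> the inequality needs \<open>k\<close> to be even, and
  homomorphisms are counted separately according to which colour class of the tree goes to the odd
  positions of \<open>P_n\<close>. An odd position has two neighbours, so a leaf whose neighbour is sent to an
  odd position contributes a factor \<open>2\<close>. With \<open>B = A / 2\<close> such leaves have no effect at all: if the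
  class sent to the odd positions has \<open>p\<close> vertices, then at least \<open>2^(m-1) y(p - 1)\<close> homomorphisms are
  of this kind, where \<open>y j = \<langle>1, B\<^sup>2\<^sup>j e\<rangle>\<close> and \<open>e\<close> is the indicator of the odd positions
  (\<open>leaf_grown_weighted_hom_parity_ge\<close>). Summing over both classes gives \<open>2^(m-1) (y(p - 1) + y(q - 1))\<close> with
  \<open>p + q = m\<close> for \<open>m \<ge> 2\<close>; paths attain equality and have \<open>\<bar>p - q\<bar> \<le> 1\<close>. Since \<open>y j = \<parallel>B\<^sup>j e\<parallel>\<^sup>2\<close>, the sequence \<open>y\<close> is
  convex, and the balanced sum is the smallest one.
\<close>

section \<open>The adjacency operator of a path\<close>

definition nbr_sum :: "nat \<Rightarrow> (nat \<Rightarrow> real) \<Rightarrow> nat \<Rightarrow> real" where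
  "nbr_sum n f i = (\<Sum>j | (i, j) \<in> parcs (path_graph n). f j)"

definition dotp :: "nat \<Rightarrow> (nat \<Rightarrow> real) \<Rightarrow> (nat \<Rightarrow> real) \<Rightarrow> real" where
  "dotp n f g = (\<Sum>i<n. f i * g i)"

lemma path_arc_iff:
  "(i, j) \<in> parcs (path_graph n) \<longleftrightarrow> i < n \<and> j < n \<and> (j = Suc i \<or> i = Suc j)"
  by (simp add: path_graph_def)

lemma path_arc_sym: "(i, j) \<in> parcs (path_graph n) \<longleftrightarrow> (j, i) \<in> parcs (path_graph n)"
  by (auto simp: path_arc_iff)

lemma pverts_path [simp]: "pverts (path_graph n) = {..<n}"
  by (simp add: path_graph_def)

lemma finite_path_nbrs [simp]: "finite {j. (i, j) \<in> parcs (path_graph n)}"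
  by (rule finite_subset[of _ "{..<n}"]) (auto simp: path_arc_iff)

lemma nbr_sum_if: "nbr_sum n f i = (\<Sum>j<n. if (i, j) \<in> parcs (path_graph n) then f j else 0)"
proof -
  have "{j. (i, j) \<in> parcs (path_graph n)} = {j \<in> {..<n}. (i, j) \<in> parcs (path_graph n)}"
    by (auto simp: path_arc_iff)
  then show ?thesis
    unfolding nbr_sum_def by (simp add: sum.If_cases Int_def)
qed

lemma nbr_sum_eq:
  assumes "i < n"
  shows "nbr_sum n f i = (if i = 0 then 0 else f (i - 1)) + (if Suc i < n then f (Suc i) else 0)"
proof -
  have "{j. (i, j) \<in> parcs (path_graph n)} =
      (if i = 0 then {} else {i - 1}) \<union> (if Suc i < n then {Suc i} else {})"
    using assms by (auto simp: path_arc_iff)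
  then show ?thesis
    unfolding nbr_sum_def by auto
qed

lemma nbr_sum_scale: "nbr_sum n (\<lambda>i. c * f i) = (\<lambda>i. c * nbr_sum n f i)"
  by (simp add: fun_eq_iff nbr_sum_def sum_distrib_left)

lemma nbr_sum_nonneg:
  assumes "\<And>j. j < n \<Longrightarrow> 0 \<le> f j"
  shows "0 \<le> nbr_sum n f i"
  using assms unfolding nbr_sum_def by (intro sum_nonneg) (auto simp: path_arc_iff)

lemma dotp_commute: "dotp n f g = dotp n g f"
  by (simp add: dotp_def mult.commute)

lemma dotp_shift: "dotp n f (\<lambda>i. g i * h i) = dotp n (\<lambda>i. f i * g i) h"
  by (simp add: dotp_def mult.assoc)

lemma dotp_scale: "dotp n f (\<lambda>i. c * g i) = c * dotp n f g"
  by (simp add: dotp_def sum_distrib_left mult_ac)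

lemma nbr_sum_self_adjoint: "dotp n (nbr_sum n f) g = dotp n f (nbr_sum n g)"
proof -
  have "dotp n (nbr_sum n f) g =
      (\<Sum>i<n. \<Sum>j<n. if (i, j) \<in> parcs (path_graph n) then f j * g i else 0)"
    unfolding dotp_def nbr_sum_if sum_distrib_right by (intro sum.cong) auto
  also have "\<dots> = (\<Sum>j<n. \<Sum>i<n. if (j, i) \<in> parcs (path_graph n) then f j * g i else 0)"
    by (subst sum.swap) (simp add: path_arc_sym)
  also have "\<dots> = dotp n f (nbr_sum n g)"
    unfolding dotp_def nbr_sum_if sum_distrib_left by (intro sum.cong) auto
  finally show ?thesis .
qed

lemma nbr_sum_pow_nonneg:
  assumes "\<And>j. j < n \<Longrightarrow> 0 \<le> f j" "i < n"
  shows "0 \<le> (nbr_sum n ^^ k) f i"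
  using assms(2) by (induction k arbitrary: i) (auto intro: nbr_sum_nonneg assms(1))

lemma nbr_sum_pow_self_adjoint: "dotp n ((nbr_sum n ^^ k) f) g = dotp n f ((nbr_sum n ^^ k) g)"
proof (induction k arbitrary: f)
  case (Suc k)
  have "dotp n ((nbr_sum n ^^ Suc k) f) g = dotp n ((nbr_sum n ^^ k) (nbr_sum n f)) g"
    by (simp add: funpow_swap1)
  also have "\<dots> = dotp n f (nbr_sum n ((nbr_sum n ^^ k) g))"
    by (simp add: Suc.IH nbr_sum_self_adjoint)
  finally show ?case by simp
qed simp

text \<open>
  The matrix entries of the powers of the adjacency operator: the number of walks of length \<open>k\<close> from
  \<open>i\<close> to \<open>j\<close>.
\<close>

definition walk_count :: "nat \<Rightarrow> nat \<Rightarrow> nat \<Rightarrow> nat \<Rightarrow> real" where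
  "walk_count n k i j = (nbr_sum n ^^ k) (\<lambda>l. of_bool (l = j)) i"

lemma nbr_sum_pow_eq_walk_count:
  assumes "i < n"
  shows "(nbr_sum n ^^ k) f i = (\<Sum>j<n. walk_count n k i j * f j)"
  using assms
proof (induction k arbitrary: i)
  case 0
  have "(\<Sum>j<n. walk_count n 0 i j * f j) = (\<Sum>j<n. if j = i then f j else 0)"
    by (intro sum.cong) (auto simp: walk_count_def)
  with 0 show ?case by simp
next
  case (Suc k)
  have "(nbr_sum n ^^ Suc k) f i =
      (\<Sum>l | (i, l) \<in> parcs (path_graph n). \<Sum>j<n. walk_count n k l j * f j)"
    unfolding funpow.simps(2) comp_def nbr_sum_def[of n _ i]
    using Suc.IH by (intro sum.cong) (auto simp: path_arc_iff)
  also have "\<dots> = (\<Sum>j<n. walk_count n (Suc k) i j * f j)"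
    by (subst sum.swap) (simp add: walk_count_def nbr_sum_def sum_distrib_right)
  finally show ?case .
qed

lemma walk_count_sym:
  assumes "i < n" "j < n"
  shows "walk_count n k i j = walk_count n k j i"
proof -
  have delta: "dotp n (\<lambda>l. of_bool (l = a)) g = g a" if "a < n" for a g
  proof -
    have "dotp n (\<lambda>l. of_bool (l = a)) g = (\<Sum>l<n. if l = a then g l else 0)"
      unfolding dotp_def by (intro sum.cong) auto
    with that show ?thesis by simp
  qed
  show ?thesis
    using nbr_sum_pow_self_adjoint[of n k "\<lambda>l. of_bool (l = j)" "\<lambda>l. of_bool (l = i)"]
    by (simp add: delta[OF assms(2)] dotp_commute[of n _ "\<lambda>l. of_bool (l = i)"]
        delta[OF assms(1)] walk_count_def)
qed

lemma walk_count_nonneg: "i < n \<Longrightarrow> 0 \<le> walk_count n k i j"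
  unfolding walk_count_def by (intro nbr_sum_pow_nonneg) auto

lemma walk_count_support:
  assumes "walk_count n k i j \<noteq> 0"
  shows "i \<le> j + k \<and> j \<le> i + k \<and> even (i + j + k)"
  using assms
proof (induction k arbitrary: i)
  case 0
  then show ?case by (auto simp: walk_count_def split: if_splits)
next
  case (Suc k)
  have "walk_count n (Suc k) i j = (\<Sum>l | (i, l) \<in> parcs (path_graph n). walk_count n k l j)"
    by (simp add: walk_count_def nbr_sum_def)
  with Suc.prems obtain l where l: "(i, l) \<in> parcs (path_graph n)" "walk_count n k l j \<noteq> 0"
    by (metis (no_types, lifting) mem_Collect_eq sum.neutral)
  have "l = Suc i \<or> i = Suc l" using l(1) by (simp add: path_arc_iff)
  with Suc.IH[OF l(2)] show ?case by auto
qed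

text \<open>
  By the symmetry of \<open>walk_count\<close>, twice the difference of the two sides is the sum of
  \<open>walk_count n k i j * ((a i - a j) * (b i - b j))\<close> over all \<open>i\<close> and \<open>j\<close>, a weighted form of Chebyshev's
  sum inequality.
\<close>

lemma comonotone_dotp_le:
  assumes "\<And>i j. \<lbrakk>i < n; j < n; walk_count n k i j \<noteq> 0\<rbrakk> \<Longrightarrow> 0 \<le> (a i - a j) * (b i - b j)"
  shows "dotp n a ((nbr_sum n ^^ k) b) \<le> dotp n (\<lambda>i. a i * b i) ((nbr_sum n ^^ k) (\<lambda>_. 1))"
proof -
  let ?W = "walk_count n k"
  have L: "dotp n a ((nbr_sum n ^^ k) b) = (\<Sum>i<n. \<Sum>j<n. ?W i j * (a i * b j))"
    unfolding dotp_def by (intro sum.cong) (auto simp: nbr_sum_pow_eq_walk_count sum_distrib_left mult_ac)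
  have L': "(\<Sum>i<n. \<Sum>j<n. ?W i j * (a i * b j)) = (\<Sum>i<n. \<Sum>j<n. ?W i j * (a j * b i))"
    by (subst sum.swap) (auto simp: walk_count_sym intro!: sum.cong)
  have R: "dotp n (\<lambda>i. a i * b i) ((nbr_sum n ^^ k) (\<lambda>_. 1)) = (\<Sum>i<n. \<Sum>j<n. ?W i j * (a i * b i))"
    unfolding dotp_def by (intro sum.cong) (auto simp: nbr_sum_pow_eq_walk_count sum_distrib_left mult_ac)
  have R': "(\<Sum>i<n. \<Sum>j<n. ?W i j * (a i * b i)) = (\<Sum>i<n. \<Sum>j<n. ?W i j * (a j * b j))"
    by (subst sum.swap) (auto simp: walk_count_sym intro!: sum.cong)
  have "0 \<le> (\<Sum>i<n. \<Sum>j<n. ?W i j * ((a i - a j) * (b i - b j)))"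
  proof (intro sum_nonneg)
    fix i j assume "i \<in> {..<n}" "j \<in> {..<n}"
    then show "0 \<le> ?W i j * ((a i - a j) * (b i - b j))"
      using assms[of i j] walk_count_nonneg[of i n k j]
      by (cases "?W i j = 0") (simp_all add: mult_nonneg_nonneg)
  qed
  also have "\<dots> = (\<Sum>i<n. \<Sum>j<n. ?W i j * (a i * b i)) + (\<Sum>i<n. \<Sum>j<n. ?W i j * (a j * b j))
      - (\<Sum>i<n. \<Sum>j<n. ?W i j * (a i * b j)) - (\<Sum>i<n. \<Sum>j<n. ?W i j * (a j * b i))"
    by (simp only: ring_distribs left_diff_distrib right_diff_distrib sum.distrib sum_subtractf)
  finally show ?thesis
    using L L' R R' by linarith
qed

section \<open>Vectors that increase towards the centre\<close>

definition centrality :: "nat \<Rightarrow> nat \<Rightarrow> nat" where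
  "centrality n i = min i (n - 1 - i)"

text \<open>
  For even \<open>n\<close> these are the symmetric unimodal vectors. For odd \<open>n\<close> the adjacency operator does not
  preserve unimodality: around the centre, neighbouring values come from different parity classes and
  need not be ordered. What it preserves is unimodality within each class.
\<close>

definition central_cone :: "nat \<Rightarrow> (nat \<Rightarrow> real) set" where
  "central_cone n = {f. (\<forall>i<n. 0 \<le> f i) \<and>
     (\<forall>i<n. \<forall>j<n. centrality n i \<le> centrality n j \<and> (even n \<or> even (i + j)) \<longrightarrow> f i \<le> f j)}"

lemma central_coneD:
  assumes "f \<in> central_cone n" "i < n" "j < n" "centrality n i \<le> centrality n j" "even n \<or> even (i + j)"
  shows "f i \<le> f j"
  using assms by (simp add: central_cone_def)

lemma central_cone_nonneg: "f \<in> central_cone n \<Longrightarrow> i < n \<Longrightarrow> 0 \<le> f i"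
  by (simp add: central_cone_def)

lemma one_in_central_cone: "(\<lambda>_. 1) \<in> central_cone n"
  by (simp add: central_cone_def)

lemma central_cone_mult:
  assumes f: "f \<in> central_cone n" and g: "g \<in> central_cone n"
  shows "(\<lambda>i. f i * g i) \<in> central_cone n"
  unfolding central_cone_def
proof (intro CollectI conjI allI impI)
  fix i assume "i < n"
  then show "0 \<le> f i * g i"
    using central_cone_nonneg[OF f] central_cone_nonneg[OF g] by simp
next
  fix i j assume "i < n" "j < n" "centrality n i \<le> centrality n j \<and> (even n \<or> even (i + j))"
  then show "f i * g i \<le> f j * g j"
    using central_coneD[OF f, of i j] central_coneD[OF g, of i j]
      central_cone_nonneg[OF f, of j] central_cone_nonneg[OF g, of i]
    by (intro mult_mono) auto
qed

lemma central_cone_scale: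
  "f \<in> central_cone n \<Longrightarrow> 0 \<le> c \<Longrightarrow> (\<lambda>i. c * f i) \<in> central_cone n"
  unfolding central_cone_def by (simp add: mult_left_mono)

lemma nbr_sum_mirror:
  assumes f: "\<And>i. i < n \<Longrightarrow> f (n - 1 - i) = f i" and i: "i < n"
  shows "nbr_sum n f (n - 1 - i) = nbr_sum n f i"
proof -
  have 1: "f (n - 1 - (i - 1)) = f (i - 1)" if "i > 0" using f[of "i - 1"] that i by simp
  have 2: "f (n - 1 - Suc i) = f (Suc i)" if "Suc i < n" using f[of "Suc i"] that by simp
  have 3: "n - 1 - (i - 1) = Suc (n - 1 - i)" if "i > 0" using that i by auto
  have 4: "n - 1 - Suc i = (n - 1 - i) - 1" by auto
  show ?thesis
    using 1 2 3 i by (auto simp: nbr_sum_eq Suc_diff_Suc)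
qed

lemma central_cone_mirror:
  assumes "f \<in> central_cone n" "i < n"
  shows "f (n - 1 - i) = f i"
proof (rule antisym)
  have p: "even n \<or> even (n - 1 - i + i)" "even n \<or> even (i + (n - 1 - i))" using assms(2) by auto
  have c: "centrality n (n - 1 - i) = centrality n i" using assms(2) by (auto simp: centrality_def)
  show "f (n - 1 - i) \<le> f i" "f i \<le> f (n - 1 - i)"
    using assms p c by (auto intro: central_coneD)
qed

text \<open>
  By symmetry it is enough to compare two positions \<open>p < q\<close> in the left half. The neighbours of \<open>q\<close>
  are then at least as central as the corresponding neighbours of \<open>p\<close>. The only danger is that
  \<open>Suc q\<close> lies beyond the centre and its mirror image falls below \<open>Suc p\<close>, and the parity condition
  excludes this.
\<close>

lemma nbr_sum_in_central_cone:
  assumes f: "f \<in> central_cone n"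
  shows "nbr_sum n f \<in> central_cone n"
proof -
  have fold: "nbr_sum n f (centrality n i) = nbr_sum n f i" if "i < n" for i
    using nbr_sum_mirror[of n f i] central_cone_mirror[OF f] that
    by (auto simp: centrality_def min_def)
  have mono: "nbr_sum n f p \<le> nbr_sum n f q"
    if "p \<le> q" "2 * q < n" "even n \<or> even (p + q)" for p q
  proof (cases "p = q")
    case False
    with that have pq: "p < q" by simp
    \<comment> \<open>The mirror image of \<open>Suc q\<close> is \<open>n - 2 - q\<close>, and it is still at least \<open>Suc p\<close>.\<close>
    have far: "p + q + 3 \<le> n"
    proof (cases "even n")
      case True then show ?thesis using that(2) pq by presburger
    next
      case False then show ?thesis using that(2,3) pq by presburger
    qed
    have "f (Suc p) \<le> f (Suc q)"
      using far pq that by (intro central_coneD[OF f]) (auto simp: centrality_def)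
    moreover have "f (p - 1) \<le> f (q - 1)" if "p > 0"
      using that \<open>2 * q < n\<close> pq \<open>even n \<or> even (p + q)\<close>
      by (intro central_coneD[OF f]) (auto simp: centrality_def)
    moreover have "0 \<le> f (q - 1)"
      using pq that by (intro central_cone_nonneg[OF f]) auto
    ultimately show ?thesis
      using far pq by (subst (1 2) nbr_sum_eq) auto
  qed simp
  show ?thesis
    unfolding central_cone_def
  proof (intro CollectI conjI allI impI)
    fix i assume "i < n"
    then show "0 \<le> nbr_sum n f i" using central_cone_nonneg[OF f] by (intro nbr_sum_nonneg)
  next
    fix i j assume ij: "i < n" "j < n" "centrality n i \<le> centrality n j \<and> (even n \<or> even (i + j))"
    have "even n \<or> even (centrality n i + centrality n j)"
      using ij by (cases "i \<le> n - 1 - i"; cases "j \<le> n - 1 - j") (auto simp: centrality_def min_def)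
    then have "nbr_sum n f (centrality n i) \<le> nbr_sum n f (centrality n j)"
      using ij by (intro mono) (auto simp: centrality_def)
    then show "nbr_sum n f i \<le> nbr_sum n f j" by (simp add: fold ij)
  qed
qed

lemma central_cone_comonotone:
  assumes "a \<in> central_cone n" "b \<in> central_cone n" "i < n" "j < n" "even n \<or> even (i + j)"
  shows "0 \<le> (a i - a j) * (b i - b j)"
proof (cases "centrality n i \<le> centrality n j")
  case True
  then show ?thesis using assms central_coneD[of _ n i j] by (simp add: mult_nonpos_nonpos)
next
  case False
  then show ?thesis using assms central_coneD[of _ n j i] by (simp add: add.commute)
qed

lemma central_cone_dotp_le:
  assumes "a \<in> central_cone n" "b \<in> central_cone n" "even n \<or> even k"
  shows "dotp n a ((nbr_sum n ^^ k) b) \<le> dotp n (\<lambda>i. a i * b i) ((nbr_sum n ^^ k) (\<lambda>_. 1))"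
proof (rule comonotone_dotp_le)
  fix i j assume ij: "i < n" "j < n" "walk_count n k i j \<noteq> 0"
  have "even (i + j + k)" using walk_count_support[OF ij(3)] by simp
  then have "even n \<or> even (i + j)" using assms(3) by presburger
  then show "0 \<le> (a i - a j) * (b i - b j)"
    by (rule central_cone_comonotone[OF assms(1,2) ij(1,2)])
qed

text \<open>
  The weights of branches of height at most \<open>h\<close>. A walk of length \<open>h\<close> that starts at \<open>h\<close> or further
  from an end of the path does not see that end, so such weights are constant in the middle; near
  the left end they increase. The condition below expresses both facts at once, as it reaches beyond
  the centre when \<open>h\<close> is small.
\<close>

definition rising_cone :: "nat \<Rightarrow> nat \<Rightarrow> (nat \<Rightarrow> real) set" where
  "rising_cone n h = {f. (\<forall>i<n. 0 \<le> f i \<and> f (n - 1 - i) = f i) \<and>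
     (\<forall>i. i + h + 2 \<le> n \<longrightarrow> f i \<le> f (Suc i))}"

lemma one_in_rising_cone: "(\<lambda>_. 1) \<in> rising_cone n h"
  by (simp add: rising_cone_def)

lemma rising_coneD:
  assumes "f \<in> rising_cone n h"
  shows "i < n \<Longrightarrow> 0 \<le> f i" "i < n \<Longrightarrow> f (n - 1 - i) = f i"
    "i + h + 2 \<le> n \<Longrightarrow> f i \<le> f (Suc i)"
  using assms by (simp_all add: rising_cone_def)

lemma rising_cone_mult:
  assumes f: "f \<in> rising_cone n h" and g: "g \<in> rising_cone n h"
  shows "(\<lambda>i. f i * g i) \<in> rising_cone n h"
  unfolding rising_cone_def
proof (intro CollectI conjI allI impI)
  fix i assume "i < n"
  with rising_coneD[OF f] rising_coneD[OF g]
  show "0 \<le> f i * g i" "f (n - 1 - i) * g (n - 1 - i) = f i * g i" by simp_all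
next
  fix i assume i: "i + h + 2 \<le> n"
  then have "i < n" "Suc i < n" by auto
  with i show "f i * g i \<le> f (Suc i) * g (Suc i)"
    using rising_coneD[OF f] rising_coneD[OF g] by (intro mult_mono) auto
qed

text \<open>
  The increment of \<open>nbr_sum n f\<close> at \<open>i\<close> is the sum of the increments of \<open>f\<close> at \<open>i - 1\<close> and at \<open>Suc i\<close>, where
  \<open>f\<close> counts as \<open>0\<close> to the left of the path. So the range of monotonicity shrinks by one.
\<close>

lemma nbr_sum_in_rising_cone:
  assumes f: "f \<in> rising_cone n h" and h: "h < h'"
  shows "nbr_sum n f \<in> rising_cone n h'"
  unfolding rising_cone_def
proof (intro CollectI conjI allI impI)
  fix i assume i: "i < n"
  show "0 \<le> nbr_sum n f i" using rising_coneD(1)[OF f] by (rule nbr_sum_nonneg)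
  show "nbr_sum n f (n - 1 - i) = nbr_sum n f i"
    using rising_coneD(2)[OF f] i by (rule nbr_sum_mirror)
next
  fix i assume i: "i + h' + 2 \<le> n"
  have "f (Suc i) \<le> f (Suc (Suc i))" using i h by (intro rising_coneD(3)[OF f]) auto
  moreover have "f (i - 1) \<le> f i" if "i > 0"
    using i h that rising_coneD(3)[OF f, of "i - 1"] by auto
  moreover have "0 \<le> f i" using i by (intro rising_coneD(1)[OF f]) auto
  ultimately show "nbr_sum n f i \<le> nbr_sum n f (Suc i)"
    using i h by (subst (1 2) nbr_sum_eq) auto
qed

lemma rising_cone_le:
  assumes "f \<in> rising_cone n h" "p \<le> q" "q + h + 1 \<le> n"
  shows "f p \<le> f q"
  using assms(2,3)
proof (induction q rule: dec_induct)
  case (step q)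
  then have "f q \<le> f (Suc q)" by (intro rising_coneD(3)[OF assms(1)]) auto
  with step show ?case by simp
qed simp

text \<open>
  Fold both positions to the left half, say \<open>q < p\<close>, and let \<open>b\<close> be the vector of smaller height \<open>h'\<close>.
  Then \<open>b\<close> increases on the whole left half. If \<open>h' \<le> q\<close>, then \<open>b\<close> is constant between \<open>q\<close> and its mirror
  image, so that \<open>b p = b q\<close>. Otherwise \<open>p \<le> q + k < h' + k\<close> is so close to the end that \<open>a\<close> still
  increases up to \<open>p\<close>.
\<close>

lemma rising_cone_comonotone:
  assumes a: "a \<in> rising_cone n h" and b: "b \<in> rising_cone n h'"
    and k: "h + h' + k + 1 \<le> n" "0 < k"
    and ij: "i < n" "j < n" "i \<le> j + k" "j \<le> i + k"
  shows "0 \<le> (a i - a j) * (b i - b j)"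
proof -
  have main: "0 \<le> (a q - a p) * (b q - b p)"
    if a: "a \<in> rising_cone n h" and b: "b \<in> rising_cone n h'" and hh: "h' \<le> h"
      and k: "h + h' + k + 1 \<le> n" and pq: "q < p" "2 * p < n" "p \<le> q + k" for a b h h' p q
  proof -
    have b1: "b q \<le> b p" using pq hh k by (intro rising_cone_le[OF b]) auto
    show ?thesis
    proof (cases "h' \<le> q")
      case True
      have "b p \<le> b (n - 1 - q)" using pq True by (intro rising_cone_le[OF b]) auto
      also have "\<dots> = b q" using pq by (intro rising_coneD(2)[OF b]) auto
      finally show ?thesis using b1 by simp
    next
      case False
      then have "a q \<le> a p" using pq k by (intro rising_cone_le[OF a]) auto
      with b1 show ?thesis by (simp add: mult_nonpos_nonpos)
    qed
  qed
  have main': "0 \<le> (a q - a p) * (b q - b p)"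
    if "q < p" "2 * p < n" "p \<le> q + k" for p q
    using main[OF a b _ _ that] main[OF b a _ _ that] k
    by (cases "h' \<le> h") (auto simp: mult.commute add_ac)
  have fold: "f (centrality n l) = f l" if "f \<in> rising_cone n h''" "l < n" for f h'' l
    using that(2) rising_coneD(2)[OF that(1)] by (auto simp: centrality_def min_def)
  let ?p = "centrality n i" and ?q = "centrality n j"
  have c: "?p \<le> ?q + k" "?q \<le> ?p + k" "2 * ?p < n" "2 * ?q < n"
    using ij by (auto simp: centrality_def)
  have "0 \<le> (a ?p - a ?q) * (b ?p - b ?q)"
    using main'[of ?p ?q] main'[of ?q ?p] c
    by (cases ?p ?q rule: linorder_cases) (auto simp: algebra_simps)
  then show ?thesis
    using fold[OF a] fold[OF b] ij by simp
qed

lemma rising_cone_dotp_le: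
  assumes "a \<in> rising_cone n h" "b \<in> rising_cone n h'" "h + h' + k + 1 \<le> n" "0 < k"
  shows "dotp n a ((nbr_sum n ^^ k) b) \<le> dotp n (\<lambda>i. a i * b i) ((nbr_sum n ^^ k) (\<lambda>_. 1))"
proof (rule comonotone_dotp_le)
  fix i j assume ij: "i < n" "j < n" "walk_count n k i j \<noteq> 0"
  show "0 \<le> (a i - a j) * (b i - b j)"
    using walk_count_support[OF ij(3)] by (intro rising_cone_comonotone[OF assms ij(1,2)]) auto
qed

section \<open>Weighted homomorphism counts and the removal of leaves\<close>

text \<open>
  Homomorphisms are defined for a vertex set and an arbitrary relation, of which only the part inside
  the vertex set counts. In this way one relation serves for all the subtrees met while pruning.
\<close>

definition path_homs :: "nat \<Rightarrow> 'a set \<Rightarrow> 'a rel \<Rightarrow> ('a \<Rightarrow> nat) set" where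
  "path_homs n V R = {h \<in> V \<rightarrow>\<^sub>E {..<n}. \<forall>u\<in>V. \<forall>v\<in>V. (u, v) \<in> R \<longrightarrow> (h u, h v) \<in> parcs (path_graph n)}"

definition weighted_hom :: "nat \<Rightarrow> 'a set \<Rightarrow> 'a rel \<Rightarrow> ('a \<Rightarrow> nat \<Rightarrow> real) \<Rightarrow> real" where
  "weighted_hom n V R \<phi> = (\<Sum>h\<in>path_homs n V R. \<Prod>v\<in>V. \<phi> v (h v))"

lemma finite_path_homs: "finite V \<Longrightarrow> finite (path_homs n V R)"
  unfolding path_homs_def by (rule finite_subset[OF _ finite_PiE[of V "\<lambda>_. {..<n}"]]) auto

lemma path_homs_less: "h \<in> path_homs n V R \<Longrightarrow> v \<in> V \<Longrightarrow> h v < n"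
  by (auto simp: path_homs_def PiE_def Pi_def)

lemma path_homs_arc:
  "h \<in> path_homs n V R \<Longrightarrow> (u, v) \<in> R \<Longrightarrow> u \<in> V \<Longrightarrow> v \<in> V \<Longrightarrow> (h u, h v) \<in> parcs (path_graph n)"
  by (auto simp: path_homs_def)

lemma path_homs_undefined: "h \<in> path_homs n V R \<Longrightarrow> a \<notin> V \<Longrightarrow> h a = undefined"
  unfolding path_homs_def by (blast intro: PiE_arb)

lemma path_homs_cong:
  assumes "\<And>u v. u \<in> V \<Longrightarrow> v \<in> V \<Longrightarrow> (u, v) \<in> R \<longleftrightarrow> (u, v) \<in> R'"
  shows "path_homs n V R = path_homs n V R'"
  using assms unfolding path_homs_def by blast

lemma weighted_hom_cong:
  assumes "\<And>v i. v \<in> V \<Longrightarrow> i < n \<Longrightarrow> \<phi> v i = \<psi> v i"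
  shows "weighted_hom n V R \<phi> = weighted_hom n V R \<psi>"
  unfolding weighted_hom_def
  by (intro sum.cong prod.cong refl assms) (auto dest: path_homs_less)

lemma weighted_hom_one: "weighted_hom n V R (\<lambda>_ _. 1) = card (path_homs n V R)"
  by (simp add: weighted_hom_def)

lemma path_homs_restrict:
  assumes "h \<in> path_homs n V R" "W \<subseteq> V"
  shows "restrict h W \<in> path_homs n W R"
  using assms unfolding path_homs_def by (auto simp: subset_iff)

lemma path_homs_extend:
  assumes h: "h \<in> path_homs n V R" and i: "(h v, i) \<in> parcs (path_graph n)"
    and leaf: "u \<notin> V" "(u, u) \<notin> R"
      "\<And>w. w \<in> V \<Longrightarrow> (w, u) \<in> R \<longleftrightarrow> w = v" "\<And>w. w \<in> V \<Longrightarrow> (u, w) \<in> R \<longleftrightarrow> w = v"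
  shows "h(u := i) \<in> path_homs n (insert u V) R"
proof -
  have "i < n" using i by (simp add: path_arc_iff)
  moreover have "(i, h v) \<in> parcs (path_graph n)" using i by (simp add: path_arc_sym)
  ultimately show ?thesis
    using h i leaf unfolding path_homs_def
    by (auto simp: PiE_def extensional_def)
qed

lemma sum_path_homs_leaf:
  fixes F :: "('a \<Rightarrow> nat) \<Rightarrow> nat \<Rightarrow> real"
  assumes R: "sym R" "\<And>a. (a, a) \<notin> R"
    and leaf: "v \<in> V" "u \<notin> V" "(v, u) \<in> R" "\<And>w. w \<in> V \<Longrightarrow> w \<noteq> v \<Longrightarrow> (w, u) \<notin> R"
    and fin: "finite V"
  shows "(\<Sum>h\<in>path_homs n (insert u V) R. F (restrict h V) (h u)) =
    (\<Sum>h\<in>path_homs n V R. nbr_sum n (F h) (h v))"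
proof -
  have leaf': "\<And>w. w \<in> V \<Longrightarrow> (w, u) \<in> R \<longleftrightarrow> w = v" "\<And>w. w \<in> V \<Longrightarrow> (u, w) \<in> R \<longleftrightarrow> w = v"
    using leaf(3,4) symD[OF R(1)] by blast+
  let ?S = "SIGMA h:path_homs n V R. {i. (h v, i) \<in> parcs (path_graph n)}"
  have "(\<Sum>h\<in>path_homs n (insert u V) R. F (restrict h V) (h u)) = (\<Sum>(h, i)\<in>?S. F h i)"
  proof (rule sum.reindex_bij_witness[of _ "\<lambda>(h, i). h(u := i)" "\<lambda>h. (restrict h V, h u)"])
    fix h assume h: "h \<in> path_homs n (insert u V) R"
    have ext: "h a = undefined" if "a \<notin> insert u V" for a
      using path_homs_undefined[OF h that] .
    show "(case (restrict h V, h u) of (h, i) \<Rightarrow> h(u := i)) = h"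
      using ext by (auto simp: fun_eq_iff restrict_def)
    show "(restrict h V, h u) \<in> ?S"
    proof (intro SigmaI)
      show "restrict h V \<in> path_homs n V R" by (rule path_homs_restrict[OF h]) blast
      show "h u \<in> {i. (restrict h V v, i) \<in> parcs (path_graph n)}"
        using path_homs_arc[OF h leaf(3)] leaf(1) by simp
    qed
    show "(case (restrict h V, h u) of (h, i) \<Rightarrow> F h i) = F (restrict h V) (h u)" by simp
  next
    fix p assume "p \<in> ?S"
    then obtain h i where p: "p = (h, i)" "h \<in> path_homs n V R" "(h v, i) \<in> parcs (path_graph n)"
      by auto
    have "restrict (h(u := i)) V = h"
      using path_homs_undefined[OF p(2)] leaf(2) by (auto simp: fun_eq_iff restrict_def)
    then show "(\<lambda>h. (restrict h V, h u)) (case p of (h, i) \<Rightarrow> h(u := i)) = p"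
      using p(1) by simp
    show "(case p of (h, i) \<Rightarrow> h(u := i)) \<in> path_homs n (insert u V) R"
      using path_homs_extend[OF p(2,3) leaf(2) R(2) leaf'] p(1) by simp
  qed
  also have "\<dots> = (\<Sum>h\<in>path_homs n V R. nbr_sum n (F h) (h v))"
    unfolding nbr_sum_def by (rule sum.Sigma[symmetric]) (simp_all add: finite_path_homs fin)
  finally show ?thesis .
qed

text \<open>
  Summing over the image of the leaf first turns its weight \<open>\<phi> u\<close> into the factor
  \<open>nbr_sum n (\<phi> u)\<close> evaluated at the image of its neighbour.
\<close>

lemma weighted_hom_leaf:
  assumes "sym R" "\<And>a. (a, a) \<notin> R"
    and leaf: "v \<in> V" "u \<notin> V" "(v, u) \<in> R" "\<And>w. w \<in> V \<Longrightarrow> w \<noteq> v \<Longrightarrow> (w, u) \<notin> R"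
    and fin: "finite V"
  shows "weighted_hom n (insert u V) R \<phi> =
    weighted_hom n V R (\<phi>(v := \<lambda>i. \<phi> v i * nbr_sum n (\<phi> u) i))"
proof -
  let ?F = "\<lambda>h i. (\<Prod>w\<in>V. \<phi> w (h w)) * \<phi> u i"
  have "weighted_hom n (insert u V) R \<phi> =
      (\<Sum>h\<in>path_homs n (insert u V) R. ?F (restrict h V) (h u))"
    unfolding weighted_hom_def using leaf fin
    by (intro sum.cong) (auto simp: mult.commute intro!: prod.cong)
  also have "\<dots> = (\<Sum>h\<in>path_homs n V R. nbr_sum n (?F h) (h v))"
    by (rule sum_path_homs_leaf[OF assms])
  also have "\<dots> = (\<Sum>h\<in>path_homs n V R. \<Prod>w\<in>V. (\<phi>(v := \<lambda>i. \<phi> v i * nbr_sum n (\<phi> u) i)) w (h w))"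
  proof (intro sum.cong refl)
    fix h
    have "(\<Prod>w\<in>V. (\<phi>(v := \<lambda>i. \<phi> v i * nbr_sum n (\<phi> u) i)) w (h w)) =
        \<phi> v (h v) * nbr_sum n (\<phi> u) (h v) * (\<Prod>w\<in>V - {v}. \<phi> w (h w))"
      using leaf(1) fin by (subst prod.remove[of V v]) (auto intro!: prod.cong)
    also have "\<dots> = (\<Prod>w\<in>V. \<phi> w (h w)) * nbr_sum n (\<phi> u) (h v)"
      using leaf(1) fin by (simp add: prod.remove[of V v])
    finally show "nbr_sum n (?F h) (h v) =
        (\<Prod>w\<in>V. (\<phi>(v := \<lambda>i. \<phi> v i * nbr_sum n (\<phi> u) i)) w (h w))"
      by (simp add: nbr_sum_scale)
  qed
  finally show ?thesis unfolding weighted_hom_def .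
qed

lemma weighted_hom_singleton:
  assumes "(x, x) \<notin> R"
  shows "weighted_hom n {x} R \<phi> = (\<Sum>i<n. \<phi> x i)"
proof -
  have "path_homs n {x} R = {x} \<rightarrow>\<^sub>E {..<n}"
    using assms by (auto simp: path_homs_def)
  moreover have "(\<Sum>h\<in>{x} \<rightarrow>\<^sub>E {..<n}. \<phi> x (h x)) = (\<Sum>i<n. \<phi> x i)"
  proof (rule sum.reindex_bij_witness[of _ "\<lambda>i. \<lambda>w\<in>{x}. i" "\<lambda>h. h x"])
    fix h assume "h \<in> {x} \<rightarrow>\<^sub>E {..<n}"
    then show "(\<lambda>w\<in>{x}. h x) = h" "h x \<in> {..<n}"
      by (auto simp: PiE_iff extensional_def fun_eq_iff)
  qed auto
  ultimately show ?thesis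
    by (simp add: weighted_hom_def)
qed

section \<open>Graphs grown by adding leaves\<close>

text \<open>
  \<open>V\<close> arises from \<open>S\<close> by attaching one vertex \<open>u\<close> after the other, each with exactly one neighbour \<open>v\<close> in
  the set built so far. The parameter \<open>P u v\<close> records what is known about each attachment.
\<close>

inductive leaf_grown :: "'a rel \<Rightarrow> ('a \<Rightarrow> 'a \<Rightarrow> bool) \<Rightarrow> 'a set \<Rightarrow> 'a set \<Rightarrow> bool"
  for R P S where
  base: "leaf_grown R P S S"
| leaf: "\<lbrakk>leaf_grown R P S V; v \<in> V; u \<notin> V; (v, u) \<in> R; \<And>w. w \<in> V \<Longrightarrow> w \<noteq> v \<Longrightarrow> (w, u) \<notin> R; P u v\<rbrakk>
    \<Longrightarrow> leaf_grown R P S (insert u V)"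

lemma leaf_grown_subset: "leaf_grown R P S V \<Longrightarrow> S \<subseteq> V"
  by (induction rule: leaf_grown.induct) auto

lemma leaf_grown_finite: "leaf_grown R P S V \<Longrightarrow> finite S \<Longrightarrow> finite V"
  by (induction rule: leaf_grown.induct) auto

lemma leaf_grown_mono:
  assumes "leaf_grown R P S V"
    and "\<And>u v. \<lbrakk>u \<in> V - S; v \<in> V; (v, u) \<in> R; P u v\<rbrakk> \<Longrightarrow> Q u v"
  shows "leaf_grown R Q S V"
  using assms
proof (induction rule: leaf_grown.induct)
  case base
  show ?case by (rule leaf_grown.base)
next
  case (leaf V v u)
  have "u \<notin> S" using leaf_grown_subset[OF leaf.hyps(1)] leaf.hyps(3) by blast
  then have "Q u v" using leaf.prems leaf.hyps(2,4,6) by blast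
  moreover have "leaf_grown R Q S V" using leaf.prems by (intro leaf.IH) blast
  ultimately show ?case using leaf.hyps(2-5) by (intro leaf_grown.leaf)
qed

text \<open>
  Induction over rooted branches without a datatype of rooted trees: \<open>I v f s\<close> relates the weight \<open>f\<close> that a
  branch leaves at its root \<open>v\<close> to an additive measure \<open>s\<close> of the branch. It is enough that \<open>I\<close> survives the
  absorption of a branch at \<open>u\<close> into a branch at an adjacent vertex \<open>v\<close>.
\<close>

lemma leaf_grown_fold:
  fixes \<sigma> :: "'a \<Rightarrow> 'm::comm_monoid_add"
  assumes "leaf_grown R P {x} V" and R: "sym R" "\<And>a. (a, a) \<notin> R"
    and absorb: "\<And>u v f g s t. (v, u) \<in> R \<Longrightarrow> I v f s \<Longrightarrow> I u g t \<Longrightarrow>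
      I v (\<lambda>i. f i * nbr_sum n g i) (s + t)"
    and "\<And>v. v \<in> V \<Longrightarrow> I v (\<phi> v) (\<sigma> v)"
  shows "\<exists>f. I x f (sum \<sigma> V) \<and> weighted_hom n V R \<phi> = (\<Sum>i<n. f i)"
  using assms(1,5)
proof (induction arbitrary: \<phi> \<sigma> rule: leaf_grown.induct)
  case base
  then show ?case by (intro exI[of _ "\<phi> x"]) (auto simp: weighted_hom_singleton R)
next
  case (leaf V v u)
  have fin: "finite V" using leaf.hyps(1) leaf_grown_finite by blast
  \<comment> \<open>Removing the leaf \<open>u\<close> merges its branch into that of \<open>v\<close>.\<close>
  let ?\<phi> = "\<phi>(v := \<lambda>i. \<phi> v i * nbr_sum n (\<phi> u) i)" and ?\<sigma> = "\<sigma>(v := \<sigma> v + \<sigma> u)"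
  have "I w (?\<phi> w) (?\<sigma> w)" if "w \<in> V" for w
    using that leaf.prems leaf.hyps by (auto intro: absorb)
  from leaf.IH[of ?\<phi> ?\<sigma>, OF this]
  obtain f where f: "I x f (sum ?\<sigma> V)" "weighted_hom n V R ?\<phi> = (\<Sum>i<n. f i)" by blast
  have "sum ?\<sigma> V = \<sigma> v + \<sigma> u + sum \<sigma> (V - {v})"
    using fin leaf.hyps(2) by (simp add: sum.remove[of V v])
  also have "\<dots> = sum \<sigma> (insert u V)"
    using fin leaf.hyps(2,3) by (simp add: sum.remove[of V v] add_ac)
  finally show ?case
    using f weighted_hom_leaf[OF R leaf.hyps(2-5) fin] by auto
qed

text \<open>
  The case of a path \<open>p 0, ..., p k\<close> with weights at its ends only. The factor \<open>f\<close> at the last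
  vertex makes the induction go through, because removing that vertex turns it into such a factor
  at the previous one.
\<close>

lemma weighted_hom_path:
  assumes R: "sym R" "\<And>a. (a, a) \<notin> R"
    and "inj_on p {..k}"
    and "\<And>i j. i \<le> k \<Longrightarrow> j \<le> k \<Longrightarrow> (p i, p j) \<in> R \<longleftrightarrow> j = Suc i \<or> i = Suc j"
    and "\<And>i. 0 < i \<Longrightarrow> i \<le> k \<Longrightarrow> \<phi> (p i) = (\<lambda>_. 1)"
  shows "weighted_hom n (p ` {..k}) R (\<phi>(p k := \<lambda>i. \<phi> (p k) i * f i)) =
    dotp n (\<phi> (p 0)) ((nbr_sum n ^^ k) f)"
  using assms(3-)
proof (induction k arbitrary: f)
  case 0
  then show ?case by (simp add: weighted_hom_singleton R dotp_def)
next
  case (Suc k)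
  have inj: "i \<le> Suc k \<Longrightarrow> j \<le> Suc k \<Longrightarrow> p i = p j \<longleftrightarrow> i = j" for i j
    using Suc.prems(1) by (simp add: inj_on_eq_iff)
  let ?\<psi> = "\<phi>(p (Suc k) := \<lambda>i. \<phi> (p (Suc k)) i * f i)"
  have set: "p ` {..Suc k} = insert (p (Suc k)) (p ` {..k})" by (simp add: atMost_Suc)
  have ne: "p (Suc k) \<noteq> p i" if "i \<le> k" for i using inj[of "Suc k" i] that by simp
  have "weighted_hom n (p ` {..Suc k}) R ?\<psi> =
      weighted_hom n (p ` {..k}) R (?\<psi>(p k := \<lambda>i. ?\<psi> (p k) i * nbr_sum n (?\<psi> (p (Suc k))) i))"
    unfolding set using Suc.prems(2)
    by (intro weighted_hom_leaf R) (auto simp: ne inj Suc.prems(2))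
  also have "\<dots> = weighted_hom n (p ` {..k}) R (\<phi>(p k := \<lambda>i. \<phi> (p k) i * nbr_sum n f i))"
  proof (rule weighted_hom_cong)
    fix v i assume "v \<in> p ` {..k}"
    then obtain j where j: "v = p j" "j \<le> k" by auto
    have "\<phi> (p (Suc k)) = (\<lambda>_. 1)" using Suc.prems(3) by simp
    then show "(?\<psi>(p k := \<lambda>i. ?\<psi> (p k) i * nbr_sum n (?\<psi> (p (Suc k))) i)) v i =
        (\<phi>(p k := \<lambda>i. \<phi> (p k) i * nbr_sum n f i)) v i"
      using j ne[of k] ne[of j] by auto
  qed
  also have "\<dots> = dotp n (\<phi> (p 0)) ((nbr_sum n ^^ k) (nbr_sum n f))"
  proof (rule Suc.IH)
    show "inj_on p {..k}" using Suc.prems(1) by (rule inj_on_subset) auto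
  qed (use Suc.prems in auto)
  finally show ?case by (simp only: funpow_Suc_right comp_def)
qed

lemma hom_path_graph_eq:
  assumes "parcs T \<subseteq> pverts T \<times> pverts T"
  shows "hom T (path_graph n) = card (path_homs n (pverts T) (parcs T))"
proof -
  have "homs T (path_graph n) = path_homs n (pverts T) (parcs T)"
    using assms unfolding homs_def path_homs_def by auto
  then show ?thesis by (simp add: hom_def)
qed

lemma hom_path_path:
  "hom (path_graph (Suc k)) (path_graph n) = dotp n (\<lambda>_. 1) ((nbr_sum n ^^ k) (\<lambda>_. 1))"
proof -
  have "real (hom (path_graph (Suc k)) (path_graph n)) =
      weighted_hom n ((\<lambda>i. i) ` {..k}) (parcs (path_graph (Suc k))) ((\<lambda>_ _. 1)(k := \<lambda>i. 1 * 1))"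
    by (subst hom_path_graph_eq)
      (auto simp: path_arc_iff weighted_hom_one[symmetric] lessThan_Suc_atMost intro!: weighted_hom_cong)
  also have "\<dots> = dotp n (\<lambda>_. 1) ((nbr_sum n ^^ k) (\<lambda>_. 1))"
    by (rule weighted_hom_path[of _ "\<lambda>i. i" k "\<lambda>_ _. 1"]) (auto simp: path_arc_iff sym_def)
  finally show ?thesis .
qed

section \<open>Moving branches along a path\<close>

text \<open>
  \<open>R'\<close> is obtained from \<open>R\<close> by moving the branches at \<open>y\<close> to \<open>x\<close>, and \<open>S\<close> consists of the path between \<open>x\<close> and
  \<open>y\<close>. Both graphs are pruned to \<open>S\<close> simultaneously. At every stage the weight which \<open>R'\<close> carries at \<open>x\<close> is
  the product of the weights which \<open>R\<close> carries at \<open>x\<close> and \<open>y\<close>, so the claim reduces to one about the path.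
  The family \<open>C\<close> collects what is known about the weights.
\<close>

lemma weighted_hom_kc_le:
  assumes "leaf_grown R P S V" and "finite S"
    and R: "sym R" "\<And>a. (a, a) \<notin> R" and R': "sym R'" "\<And>a. (a, a) \<notin> R'"
    and xy: "x \<in> S" "y \<in> S" "x \<noteq> y"
    and R'_inside: "\<And>a b. a \<in> S \<Longrightarrow> b \<in> S \<Longrightarrow> (a, b) \<in> R \<longleftrightarrow> (a, b) \<in> R'"
    and R'_outside: "\<And>w u. u \<notin> S \<Longrightarrow> (w, u) \<in> R' \<longleftrightarrow> ((w, u) \<in> R \<and> w \<noteq> y) \<or> (w = x \<and> (y, u) \<in> R)"
    and interior: "\<And>u v. u \<notin> S \<Longrightarrow> v \<in> S \<Longrightarrow> (v, u) \<in> R \<Longrightarrow> v = x \<or> v = y"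
    and C_mult: "\<And>v f g. f \<in> C v \<Longrightarrow> g \<in> C v \<Longrightarrow> (\<lambda>i. f i * g i) \<in> C v"
    and C_step: "\<And>u v f. P u v \<Longrightarrow> f \<in> C u \<Longrightarrow> nbr_sum n f \<in> C v"
    and on_path: "\<And>\<phi>. \<lbrakk>\<phi> x \<in> C x; \<phi> y \<in> C y; \<And>v. v \<in> S - {x, y} \<Longrightarrow> \<phi> v = (\<lambda>_. 1)\<rbrakk> \<Longrightarrow>
      weighted_hom n S R \<phi> \<le> weighted_hom n S R (\<phi>(x := \<lambda>i. \<phi> x i * \<phi> y i, y := \<lambda>_. 1))"
    and "\<And>v. v \<in> V \<Longrightarrow> \<phi> v \<in> C v" and "\<And>v. v \<in> S - {x, y} \<Longrightarrow> \<phi> v = (\<lambda>_. 1)"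
  shows "weighted_hom n V R \<phi> \<le> weighted_hom n V R' (\<phi>(x := \<lambda>i. \<phi> x i * \<phi> y i, y := \<lambda>_. 1))"
  using assms(1) assms(16,17)
proof (induction arbitrary: \<phi> rule: leaf_grown.induct)
  case base
  have "path_homs n S R = path_homs n S R'" using R'_inside by (rule path_homs_cong)
  then have eq: "weighted_hom n S R' = weighted_hom n S R" by (simp add: weighted_hom_def fun_eq_iff)
  show ?case unfolding eq using base xy by (intro on_path) blast+
next
  case (leaf V v u)
  note leaf' = leaf.hyps(2-6)
  have fin: "finite V" using leaf.hyps(1) leaf_grown_finite \<open>finite S\<close> by blast
  have SV: "S \<subseteq> V" using leaf.hyps(1) by (rule leaf_grown_subset)
  have uS: "u \<notin> S" "u \<noteq> x" "u \<noteq> y" using SV leaf'(2) xy by auto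
  let ?\<phi> = "\<phi>(v := \<lambda>i. \<phi> v i * nbr_sum n (\<phi> u) i)"
  let ?\<psi> = "\<phi>(x := \<lambda>i. \<phi> x i * \<phi> y i, y := \<lambda>_. 1)"
  \<comment> \<open>The vertex at which \<open>u\<close> hangs in \<open>R'\<close>.\<close>
  define v' where "v' = (if v = y then x else v)"
  have "weighted_hom n (insert u V) R \<phi> = weighted_hom n V R ?\<phi>"
    by (rule weighted_hom_leaf[OF R leaf'(1-4) fin])
  also have "\<dots> \<le> weighted_hom n V R' (?\<phi>(x := \<lambda>i. ?\<phi> x i * ?\<phi> y i, y := \<lambda>_. 1))"
  proof (rule leaf.IH)
    fix w assume "w \<in> V"
    then show "?\<phi> w \<in> C w" using leaf.prems(1) leaf'(1,5) by (auto intro!: C_mult C_step)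
  next
    fix w assume w: "w \<in> S - {x, y}"
    then have "w \<noteq> v" using interior[OF uS(1), of v] leaf'(3) by auto
    then show "?\<phi> w = (\<lambda>_. 1)" using leaf.prems(2) w by simp
  qed
  also have "?\<phi>(x := \<lambda>i. ?\<phi> x i * ?\<phi> y i, y := \<lambda>_. 1) =
      ?\<psi>(v' := \<lambda>i. ?\<psi> v' i * nbr_sum n (?\<psi> u) i)"
    using uS xy(3) by (auto simp: v'_def fun_eq_iff)
  also have "weighted_hom n V R' \<dots> = weighted_hom n (insert u V) R' ?\<psi>"
  proof (rule weighted_hom_leaf[symmetric, OF R' _ leaf'(2) _ _ fin])
    show "v' \<in> V" using leaf'(1) xy SV by (auto simp: v'_def)
    show "(v', u) \<in> R'" using R'_outside[OF uS(1)] leaf'(3) by (auto simp: v'_def)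
    fix w assume "w \<in> V" "w \<noteq> v'"
    then show "(w, u) \<notin> R'"
      using R'_outside[OF uS(1), of w] leaf'(4)[of w] leaf'(4)[of y] xy SV
      by (cases "v = y") (auto simp: v'_def)
  qed
  finally show ?case .
qed

section \<open>Trees are grown by adding leaves\<close>

definition connected_within :: "'a rel \<Rightarrow> 'a set \<Rightarrow> bool" where
  "connected_within R S \<longleftrightarrow> (\<forall>a\<in>S. \<forall>b\<in>S. (a, b) \<in> (R \<inter> S \<times> S)\<^sup>*)"

lemma connected_within_singleton: "connected_within R {x}"
  by (simp add: connected_within_def)

lemma connected_within_insert:
  assumes "sym R" "connected_within R S" "v \<in> S" "(v, u) \<in> R"
  shows "connected_within R (insert u S)"
proof -
  let ?E = "R \<inter> insert u S \<times> insert u S"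
  have old: "(a, b) \<in> ?E\<^sup>*" if "a \<in> S" "b \<in> S" for a b
    using assms(2) that rtrancl_mono[of "R \<inter> S \<times> S" ?E] unfolding connected_within_def by blast
  have vu: "(v, u) \<in> ?E" "(u, v) \<in> ?E" using assms(3,4) symD[OF assms(1,4)] by auto
  show ?thesis
    unfolding connected_within_def
  proof (intro ballI)
    fix a b assume ab: "a \<in> insert u S" "b \<in> insert u S"
    have "(a, v) \<in> ?E\<^sup>*" using ab(1) old[of a v] assms(3) vu(2) by blast
    moreover have "(v, b) \<in> ?E\<^sup>*" using ab(2) old[of v b] assms(3) vu(1) by blast
    ultimately show "(a, b) \<in> ?E\<^sup>*" by (rule rtrancl_trans)
  qed
qed

locale undirected_tree_graph = pair_graph G for G :: "'a pair_pre_digraph" +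
  assumes conn: "Digraph_Component.connected (with_proj G)"
    and acyclic: "\<not> (\<exists>c. pre_digraph.cycle (with_proj G) c \<and> length c \<ge> 3)"
begin

lemma sym_parcs: "sym (parcs G)"
  using pair_sym_arcs by (simp add: symmetric_def)

lemma irrefl_parcs: "(a, a) \<notin> parcs G"
  using pair_no_loops by force

lemma parcs_subset: "parcs G \<subseteq> pverts G \<times> pverts G"
  using arc_fst_in_verts arc_snd_in_verts by fastforce

lemma pverts_nonempty: "pverts G \<noteq> {}"
  using conn by (auto simp: connected_conv)

lemma connected_within_awalk:
  assumes "(a, b) \<in> (parcs G \<inter> S \<times> S)\<^sup>*" "a \<in> S" "S \<subseteq> pverts G"
  shows "\<exists>p. awalk a p b \<and> set (pawalk_verts a p) \<subseteq> S"
  using assms(1)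
proof (induction rule: converse_rtrancl_induct)
  case base
  have "b \<in> S" using assms(1,2) by (metis IntE mem_Sigma_iff rtranclE)
  then show ?case using assms(3) by (intro exI[of _ "[]"]) (auto simp: awalk_Nil_iff)
next
  case (step y z)
  then obtain p where "awalk z p b" "set (pawalk_verts z p) \<subseteq> S" by blast
  with step(1) show ?case by (intro exI[of _ "(y, z) # p"]) (auto simp: awalk_Cons_iff)
qed

text \<open>
  Two neighbours of \<open>u\<close> in a connected set avoiding \<open>u\<close> would close a cycle through \<open>u\<close>. Its length is
  at least three because the two neighbours differ.
\<close>

lemma unique_neighbor:
  assumes S: "connected_within (parcs G) S" "S \<subseteq> pverts G"
    and vw: "v \<in> S" "w \<in> S" "(v, u) \<in> parcs G" "(w, u) \<in> parcs G" and u: "u \<notin> S"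
  shows "w = v"
proof (rule ccontr)
  assume ne: "w \<noteq> v"
  have "(v, w) \<in> (parcs G \<inter> S \<times> S)\<^sup>*" using S(1) vw(1,2) by (auto simp: connected_within_def)
  from connected_within_awalk[OF this vw(1) S(2)] obtain p
    where p: "awalk v p w" "set (pawalk_verts v p) \<subseteq> S" by blast
  let ?q = "awalk_to_apath p"
  have q': "awalk v ?q w" "distinct (pawalk_verts v ?q)"
    using apath_awalk_to_apath[OF p(1)] by (auto simp: apath_def)
  have q: "set (pawalk_verts v ?q) \<subseteq> S"
    using p(2) awalk_to_apath_subset[OF p(1)]
    unfolding set_awalk_verts[OF p(1)] set_awalk_verts[OF q'(1)] by auto
  have "?q \<noteq> []" using q'(1) ne by (auto simp: awalk_Nil_iff)
  then have len: "length ?q \<ge> 1" by (cases ?q) auto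
  have uv: "(u, v) \<in> parcs G" using symD[OF sym_parcs vw(3)] .
  \<comment> \<open>The cycle starts at \<open>u\<close>, so the repeated vertex is exactly the one which \<open>tl\<close> removes.\<close>
  let ?c = "(u, v) # ?q @ [(w, u)]"
  have c: "awalk u ?c u"
    using q'(1) uv vw(4) arc_snd_in_verts[OF vw(4)] by (auto simp: awalk_simps)
  have verts: "pawalk_verts v (?q @ [(w, u)]) = pawalk_verts v ?q @ [u]"
    using awalk_verts_append[of v ?q "[(w, u)]" u] c q'(1) by (auto simp: awalk_simps)
  have "cycle ?c"
    unfolding cycle_def using c q'(2) q u
    by (intro exI[of _ u] conjI) (auto simp: verts)
  moreover have "length ?c \<ge> 3" using len by simp
  ultimately show False using acyclic by blast
qed

lemma frontier_arc:
  assumes "S \<subset> pverts G" "S \<noteq> {}"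
  shows "\<exists>v u. v \<in> S \<and> u \<in> pverts G - S \<and> (v, u) \<in> parcs G"
proof -
  obtain a b where ab: "a \<in> S" "b \<in> pverts G" "b \<notin> S" using assms by blast
  have "strongly_connected (with_proj G)"
    using symmetric_connected_imp_strongly_connected pair_sym_arcs conn by blast
  then have "a \<rightarrow>\<^sup>*\<^bsub>with_proj G\<^esub> b" using ab assms by (auto simp: strongly_connected_def)
  then obtain p where "awalk a p b" by (auto simp: reachable_awalk)
  then show ?thesis using ab(1,3)
  proof (induction p arbitrary: a)
    case Nil
    then show ?case by (simp add: awalk_Nil_iff)
  next
    case (Cons e p)
    obtain c where e: "e = (a, c)" "(a, c) \<in> parcs G" "awalk c p b"
      using Cons.prems(1) by (cases e) (auto simp: awalk_Cons_iff)
    show ?case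
    proof (cases "c \<in> S")
      case True
      then show ?thesis using Cons.IH[OF e(3)] Cons.prems(3) by blast
    next
      case False
      then show ?thesis using e(2) Cons.prems(2) arc_snd_in_verts[OF e(2)] by auto
    qed
  qed
qed

lemma leaf_grown_from:
  assumes "connected_within (parcs G) S" "S \<noteq> {}" "S \<subseteq> pverts G"
  shows "leaf_grown (parcs G) (\<lambda>_ _. True) S (pverts G)"
proof -
  have "leaf_grown (parcs G) (\<lambda>_ _. True) S (pverts G)"
    if "leaf_grown (parcs G) (\<lambda>_ _. True) S V" "connected_within (parcs G) V" "V \<subseteq> pverts G" for V
    using that
  proof (induction "card (pverts G - V)" arbitrary: V rule: less_induct)
    case less
    show ?case
    proof (cases "V = pverts G")
      case True
      then show ?thesis using less.prems(1) by simp
    next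
      case False
      have "V \<noteq> {}" using leaf_grown_subset[OF less.prems(1)] assms(2) by blast
      with False less.prems(3) obtain v u
        where vu: "v \<in> V" "u \<in> pverts G - V" "(v, u) \<in> parcs G"
        using frontier_arc[of V] by blast
      show ?thesis
      proof (rule less.hyps)
        show "card (pverts G - insert u V) < card (pverts G - V)"
          using vu pair_finite_verts by (intro psubset_card_mono) auto
        show "leaf_grown (parcs G) (\<lambda>_ _. True) S (insert u V)"
          using vu unique_neighbor[OF less.prems(2,3) vu(1) _ vu(3)]
          by (intro leaf_grown.leaf[OF less.prems(1) vu(1)]) blast+
        show "connected_within (parcs G) (insert u V)"
          using connected_within_insert[OF sym_parcs less.prems(2) vu(1,3)] .
        show "insert u V \<subseteq> pverts G" using vu less.prems(3) by auto
      qed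
    qed
  qed
  from this[OF leaf_grown.base assms(1,3)] show ?thesis .
qed

text \<open>
  Distances in the tree are only ever bounded from below, and for this a potential that
  changes by at most one along each arc is enough; no shortest path has to be exhibited.
\<close>

lemma potential_diff_le_dist:
  fixes F :: "'a \<Rightarrow> int"
  assumes F: "\<And>a b. (a, b) \<in> parcs G \<Longrightarrow> F b \<le> F a + 1"
  shows "ereal (of_int (F b - F a)) \<le> graph_dist G a b"
proof -
  have len: "F b - F a \<le> int (length p)" if "awalk a p b" for p
    using that
  proof (induction p arbitrary: a)
    case Nil
    then show ?case by (simp add: awalk_Nil_iff)
  next
    case (Cons e p)
    then obtain c where e: "(a, c) \<in> parcs G" "awalk c p b"
      by (cases e) (auto simp: awalk_Cons_iff)
    show ?case using Cons.IH[OF e(2)] F[OF e(1)] by simp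
  qed
  have cost: "awalk_cost (\<lambda>_. 1) p = real (length p)" for p :: "('a \<times> 'a) list"
    by (induction p) auto
  show ?thesis
    unfolding graph_dist_def \<mu>_def
  proof (rule INF_greatest)
    fix p assume "p \<in> {p. awalk a p b}"
    then have "real_of_int (F b - F a) \<le> real (length p)" using len[of p] by force
    then show "ereal (of_int (F b - F a)) \<le> ereal (awalk_cost (\<lambda>_. 1) p)"
      by (simp add: cost)
  qed
qed

lemma graph_dist_le_diam:
  assumes "a \<in> pverts G" "b \<in> pverts G"
  shows "graph_dist G a b \<le> diam G"
proof -
  have "{graph_dist G u v | u v. u \<in> pverts G \<and> v \<in> pverts G} =
      (\<lambda>(u, v). graph_dist G u v) ` (pverts G \<times> pverts G)" by auto
  then have "finite {graph_dist G u v | u v. u \<in> pverts G \<and> v \<in> pverts G}"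
    using pair_finite_verts by simp
  then show ?thesis unfolding diam_def using assms by (intro Max_ge) auto
qed

end

section \<open>The star has the most homomorphisms\<close>

lemma leaf_grown_coloring:
  assumes "leaf_grown R P {x} V" and R: "sym R" "\<And>a. (a, a) \<notin> R"
  shows "\<exists>col :: 'a \<Rightarrow> bool. \<forall>a\<in>V. \<forall>b\<in>V. (a, b) \<in> R \<longrightarrow> col a \<noteq> col b"
  using assms(1)
proof (induction rule: leaf_grown.induct)
  case base
  then show ?case using R by auto
next
  case (leaf V v u)
  then obtain col where col: "\<And>a b. a \<in> V \<Longrightarrow> b \<in> V \<Longrightarrow> (a, b) \<in> R \<Longrightarrow> col a \<noteq> (col b :: bool)"
    by blast
  let ?c = "col(u := \<not> col v)"
  have out: "(u, w) \<notin> R" if "w \<in> V" "w \<noteq> v" for w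
    using leaf.hyps(5)[OF that] symD[OF R(1)] by blast
  have "?c a \<noteq> ?c b" if "a \<in> insert u V" "b \<in> insert u V" "(a, b) \<in> R" for a b
    using that col leaf.hyps(3,5) out R(2) by (cases "a = u"; cases "b = u") auto
  then show ?case by blast
qed

lemma leaf_grown_arc:
  assumes "leaf_grown R P {x} V" "V \<noteq> {x}"
  shows "\<exists>a\<in>V. \<exists>b\<in>V. (a, b) \<in> R"
  using assms by (cases rule: leaf_grown.cases) auto

text \<open>
  Adding a leaf at \<open>v\<close> replaces the count by the sum over all \<open>h\<close> of the degree of \<open>h v\<close>. The degree is two
  except at the ends of the path, and each end is the image of \<open>v\<close> under some homomorphism: the tree is
  bipartite and can be folded onto the edge at that end.
\<close>

lemma leaf_grown_card_path_homs_le: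
  assumes "leaf_grown R P {x} V" and R: "sym R" "\<And>a. (a, a) \<notin> R" and n: "2 \<le> n"
  shows "real (card (path_homs n V R)) \<le> (real n - 2) * 2 ^ (card V - 1) + 2"
  using assms(1)
proof (induction rule: leaf_grown.induct)
  case base
  have "real (card (path_homs n {x} R)) = n"
    using weighted_hom_singleton[of x R n "\<lambda>_ _. 1"] R by (simp add: weighted_hom_one)
  then show ?case by simp
next
  case (leaf V v u)
  let ?H = "path_homs n V R" and ?deg = "nbr_sum n (\<lambda>_. 1)"
  have fin: "finite V" using leaf.hyps(1) leaf_grown_finite by blast
  have deg: "?deg i \<le> 2" "i = 0 \<or> i = n - 1 \<Longrightarrow> ?deg i \<le> 1" if "i < n" for i
    using that by (auto simp: nbr_sum_eq)
  obtain col :: "'a \<Rightarrow> bool" where col: "\<And>a b. a \<in> V \<Longrightarrow> b \<in> V \<Longrightarrow> (a, b) \<in> R \<Longrightarrow> col a \<noteq> col b"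
    using leaf_grown_coloring[OF leaf.hyps(1) R] by blast
  have two: "(\<lambda>w\<in>V. if col w = col v then i else j) \<in> ?H" if "(i, j) \<in> parcs (path_graph n)" for i j
    using that col path_arc_sym[of i j n] unfolding path_homs_def by (auto simp: path_arc_iff)
  define h0 where "h0 = (\<lambda>w\<in>V. if col w = col v then 0 else 1 :: nat)"
  define h1 where "h1 = (\<lambda>w\<in>V. if col w = col v then n - 1 else n - 2)"
  have "(0, 1) \<in> parcs (path_graph n)" "(n - 1, n - 2) \<in> parcs (path_graph n)"
    unfolding path_arc_iff using n by arith+
  then have h: "h0 \<in> ?H" "h1 \<in> ?H" "h0 v = 0" "h1 v = n - 1"
    using two leaf.hyps(2) by (auto simp: h0_def h1_def)
  then have ne: "h0 \<noteq> h1" using n by auto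
  have "2 \<le> (\<Sum>g\<in>{h0, h1}. 2 - ?deg (g v))"
    using ne h deg(2)[of 0] deg(2)[of "n - 1"] n by simp
  also have "\<dots> \<le> (\<Sum>g\<in>?H. 2 - ?deg (g v))"
    using h(1,2) deg(1)[OF path_homs_less[OF _ leaf.hyps(2)]]
    by (intro sum_mono2) (auto simp: finite_path_homs fin)
  finally have "(\<Sum>g\<in>?H. ?deg (g v)) \<le> 2 * real (card ?H) - 2"
    by (simp add: sum_subtractf)
  moreover have "real (card (path_homs n (insert u V) R)) = (\<Sum>g\<in>?H. ?deg (g v))"
    using sum_path_homs_leaf[OF R leaf.hyps(2-5) fin, where n = n and F = "\<lambda>_ _. 1"] by simp
  moreover have "card (insert u V) - 1 = Suc (card V - 1)"
    using fin leaf.hyps(2,3) card_gt_0_iff[of V] by auto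
  ultimately show ?case using leaf.IH by (simp add: algebra_simps)
qed

lemma weighted_hom_star:
  assumes "k < m"
  shows "weighted_hom n {..k} (parcs (star_graph m)) ((\<lambda>_ _. 1)(0 := f)) =
    (\<Sum>i<n. f i * nbr_sum n (\<lambda>_. 1) i ^ k)"
  using assms
proof (induction k arbitrary: f)
  case 0
  have "(0, 0) \<notin> parcs (star_graph m)" by (simp add: star_graph_def)
  from weighted_hom_singleton[OF this, of n "(\<lambda>_ _. 1)(0 := f)"]
  show ?case by (simp only: atMost_0 power_0 mult_1_right fun_upd_same)
next
  case (Suc k)
  let ?R = "parcs (star_graph m)" and ?\<phi> = "(\<lambda>_ _. 1)(0 := f) :: nat \<Rightarrow> nat \<Rightarrow> real"
  have "weighted_hom n {..Suc k} ?R ?\<phi> = weighted_hom n {..k} ?R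
      (?\<phi>(0 := \<lambda>i. ?\<phi> 0 i * nbr_sum n (?\<phi> (Suc k)) i))"
    unfolding atMost_Suc using Suc.prems
    by (intro weighted_hom_leaf) (auto simp: star_graph_def sym_def)
  also have "?\<phi>(0 := \<lambda>i. ?\<phi> 0 i * nbr_sum n (?\<phi> (Suc k)) i) =
      (\<lambda>_ _. 1)(0 := \<lambda>i. f i * nbr_sum n (\<lambda>_. 1) i)"
    by (simp add: fun_eq_iff)
  also have "weighted_hom n {..k} ?R \<dots> =
      (\<Sum>i<n. (f i * nbr_sum n (\<lambda>_. 1) i) * nbr_sum n (\<lambda>_. 1) i ^ k)"
    using Suc.prems by (intro Suc.IH) simp
  finally show ?case by (simp only: power_Suc mult.assoc)
qed

lemma hom_star_path:
  "hom (star_graph (Suc k)) (path_graph n) = (\<Sum>i<n. nbr_sum n (\<lambda>_. 1) i ^ k)"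
proof -
  have "real (hom (star_graph (Suc k)) (path_graph n)) =
      weighted_hom n {..k} (parcs (star_graph (Suc k))) ((\<lambda>_ _. 1)(0 := \<lambda>_. 1))"
    by (subst hom_path_graph_eq)
      (auto simp: star_graph_def weighted_hom_one[symmetric] lessThan_Suc_atMost intro!: weighted_hom_cong)
  then show ?thesis using weighted_hom_star[of k "Suc k" n "\<lambda>_. 1"] by simp
qed

lemma hom_star_path_eq:
  assumes "2 \<le> n"
  shows "hom (star_graph (Suc k)) (path_graph n) = (real n - 2) * 2 ^ k + 2"
proof -
  obtain l where l: "n = Suc (Suc l)" using assms by (metis add_2_eq_Suc le_Suc_ex)
  have "(\<Sum>i<l. nbr_sum n (\<lambda>_. 1) (Suc i) ^ k) = (\<Sum>i<l. 2 ^ k)"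
    by (intro sum.cong) (auto simp: nbr_sum_eq l)
  then have "(\<Sum>i<n. nbr_sum n (\<lambda>_. 1) i ^ k) = 1 + (\<Sum>i<l. 2 ^ k) + 1"
    unfolding l by (subst sum.lessThan_Suc, subst sum.lessThan_Suc_shift) (simp add: nbr_sum_eq)
  then show ?thesis by (simp add: hom_star_path l)
qed

section \<open>The path has the fewest homomorphisms: even targets\<close>

text \<open>
  The dual order of the central cone. Here \<open>r\<close> stands for the weight contributed by the rest
  of the tree, so replacing the weight of a branch by one that it outweighs cannot increase the count.
\<close>

definition outweighs :: "nat \<Rightarrow> (nat \<Rightarrow> real) \<Rightarrow> (nat \<Rightarrow> real) \<Rightarrow> bool" where
  "outweighs n f g \<longleftrightarrow> (\<forall>r\<in>central_cone n. dotp n r g \<le> dotp n r f)"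

lemma outweighs_trans: "outweighs n f g \<Longrightarrow> outweighs n g h \<Longrightarrow> outweighs n f h"
  unfolding outweighs_def by (blast intro: order_trans)

lemma outweighs_refl: "outweighs n f f"
  by (simp add: outweighs_def)

lemma outweighs_scale: "outweighs n f g \<Longrightarrow> 0 \<le> c \<Longrightarrow> outweighs n (\<lambda>i. c * f i) (\<lambda>i. c * g i)"
  by (simp add: outweighs_def dotp_scale mult_left_mono)

lemma outweighs_nbr_sum: "outweighs n f g \<Longrightarrow> outweighs n (nbr_sum n f) (nbr_sum n g)"
  by (simp add: outweighs_def nbr_sum_self_adjoint[symmetric] nbr_sum_in_central_cone)

lemma outweighs_mult:
  assumes "outweighs n f f'" "outweighs n g g'" "f \<in> central_cone n" "g' \<in> central_cone n"
  shows "outweighs n (\<lambda>i. f i * g i) (\<lambda>i. f' i * g' i)"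
  unfolding outweighs_def
proof
  fix r assume r: "r \<in> central_cone n"
  have "dotp n r (\<lambda>i. f' i * g' i) = dotp n (\<lambda>i. r i * g' i) f'"
    by (simp add: dotp_def mult_ac)
  also have "\<dots> \<le> dotp n (\<lambda>i. r i * g' i) f"
    using assms(1) central_cone_mult[OF r assms(4)] by (simp add: outweighs_def)
  also have "\<dots> = dotp n (\<lambda>i. r i * f i) g'" by (simp add: dotp_def mult_ac)
  also have "\<dots> \<le> dotp n (\<lambda>i. r i * f i) g"
    using assms(2) central_cone_mult[OF r assms(3)] by (simp add: outweighs_def)
  also have "\<dots> = dotp n r (\<lambda>i. f i * g i)" by (simp add: dotp_shift)
  finally show "dotp n r (\<lambda>i. f' i * g' i) \<le> dotp n r (\<lambda>i. f i * g i)" .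
qed

lemma nbr_sum_pow_in_central_cone:
  "f \<in> central_cone n \<Longrightarrow> (nbr_sum n ^^ k) f \<in> central_cone n"
  by (induction k) (auto intro: nbr_sum_in_central_cone)

text \<open>
  Two walks of lengths \<open>k\<close> and \<open>l\<close> attached at the same vertex compared to one walk of length \<open>k + l\<close>:
  this is the KC-inequality for paths, tested against all \<open>r\<close>.
\<close>

lemma outweighs_walks_even:
  assumes "even n"
  shows "outweighs n (\<lambda>i. (nbr_sum n ^^ k) (\<lambda>_. 1) i * (nbr_sum n ^^ l) (\<lambda>_. 1) i)
    ((nbr_sum n ^^ (k + l)) (\<lambda>_. 1))"
  unfolding outweighs_def
proof
  fix r assume r: "r \<in> central_cone n"
  let ?w = "\<lambda>k. (nbr_sum n ^^ k) (\<lambda>_. 1)"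
  have "dotp n r (?w (k + l)) = dotp n r ((nbr_sum n ^^ k) (?w l))" by (simp add: funpow_add)
  also have "\<dots> \<le> dotp n (\<lambda>i. r i * ?w l i) (?w k)"
    using assms r by (intro central_cone_dotp_le nbr_sum_pow_in_central_cone one_in_central_cone) auto
  also have "\<dots> = dotp n r (\<lambda>i. ?w k i * ?w l i)" by (simp add: dotp_def mult_ac)
  finally show "dotp n r (?w (k + l)) \<le> dotp n r (\<lambda>i. ?w k i * ?w l i)" .
qed

lemma leaf_grown_path_homs_ge_even:
  assumes "leaf_grown R P {x} V" "sym R" "\<And>a. (a, a) \<notin> R" and n: "even n"
  shows "dotp n (\<lambda>_. 1) ((nbr_sum n ^^ (card V - 1)) (\<lambda>_. 1)) \<le> card (path_homs n V R)"
proof -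
  define I where "I = (\<lambda>(_::'a) f s. f \<in> central_cone n \<and> 1 \<le> s \<and>
    outweighs n f ((nbr_sum n ^^ (s - 1)) (\<lambda>_. 1)))"
  have "\<exists>f. I x f (\<Sum>v\<in>V. 1) \<and> weighted_hom n V R (\<lambda>_ _. 1) = (\<Sum>i<n. f i)"
  proof (rule leaf_grown_fold[OF assms(1-3)])
    fix u v f g s t assume "I v f s" "I u g t"
    then have f: "f \<in> central_cone n" "1 \<le> s" "outweighs n f ((nbr_sum n ^^ (s - 1)) (\<lambda>_. 1))"
      and g: "g \<in> central_cone n" "1 \<le> t" "outweighs n g ((nbr_sum n ^^ (t - 1)) (\<lambda>_. 1))"
      by (auto simp: I_def)
    have "nbr_sum n ((nbr_sum n ^^ (t - 1)) (\<lambda>_. 1)) = (nbr_sum n ^^ t) (\<lambda>_. 1)"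
      using g(2) by (cases t) auto
    with outweighs_nbr_sum[OF g(3)] have Ag: "outweighs n (nbr_sum n g) ((nbr_sum n ^^ t) (\<lambda>_. 1))"
      by simp
    have "outweighs n (\<lambda>i. f i * nbr_sum n g i) ((nbr_sum n ^^ (s - 1 + t)) (\<lambda>_. 1))"
      using outweighs_mult[OF f(3) Ag f(1)] outweighs_walks_even[OF n]
      by (blast intro: outweighs_trans nbr_sum_pow_in_central_cone one_in_central_cone)
    then show "I v (\<lambda>i. f i * nbr_sum n g i) (s + t)"
      using f g by (simp add: I_def central_cone_mult nbr_sum_in_central_cone)
  qed (auto simp: I_def one_in_central_cone outweighs_refl)
  then obtain f where f: "I x f (card V)" "real (card (path_homs n V R)) = (\<Sum>i<n. f i)"
    by (auto simp: weighted_hom_one)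
  have "dotp n (\<lambda>_. 1) ((nbr_sum n ^^ (card V - 1)) (\<lambda>_. 1)) \<le> dotp n (\<lambda>_. 1) f"
    using f(1) one_in_central_cone by (auto simp: I_def outweighs_def)
  then show ?thesis by (simp add: f(2) dotp_def)
qed

section \<open>The path has the fewest homomorphisms: odd targets\<close>

definition half_sum :: "nat \<Rightarrow> (nat \<Rightarrow> real) \<Rightarrow> nat \<Rightarrow> real" where
  "half_sum n f i = nbr_sum n f i / 2"

text \<open>
  The indicator of one parity class of positions. For odd \<open>n\<close> the class \<open>True\<close> (positions
  \<open>0, 2, ..., n - 1\<close>) contains both ends, and every position in the class \<open>False\<close> has two neighbours.
\<close>

definition parity_vec :: "nat \<Rightarrow> bool \<Rightarrow> nat \<Rightarrow> real" where
  "parity_vec n b i = of_bool (i < n \<and> even i = b)"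

lemma half_sum_eq: "half_sum n f = (\<lambda>i. (1 / 2) * nbr_sum n f i)"
  by (simp add: half_sum_def fun_eq_iff)

lemma half_sum_scale: "half_sum n (\<lambda>i. c * f i) = (\<lambda>i. c * half_sum n f i)"
  by (simp add: half_sum_eq nbr_sum_scale)

lemma half_sum_pow_eq: "(half_sum n ^^ k) f = (\<lambda>i. (1 / 2) ^ k * (nbr_sum n ^^ k) f i)"
proof (induction k)
  case (Suc k)
  show ?case
    unfolding funpow.simps comp_def Suc.IH half_sum_scale by (simp add: half_sum_def mult_ac fun_eq_iff)
qed simp

lemma half_sum_pow_self_adjoint: "dotp n ((half_sum n ^^ k) f) g = dotp n f ((half_sum n ^^ k) g)"
proof -
  have "dotp n (\<lambda>i. c * f i) g = c * dotp n f g" for c f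
    by (simp add: dotp_def sum_distrib_left mult.assoc)
  then show ?thesis
    unfolding half_sum_pow_eq by (simp only: dotp_scale nbr_sum_pow_self_adjoint)
qed

lemma half_sum_in_central_cone: "f \<in> central_cone n \<Longrightarrow> half_sum n f \<in> central_cone n"
  by (simp add: half_sum_eq central_cone_scale nbr_sum_in_central_cone del: times_divide_eq_left)

lemma half_sum_pow_in_central_cone: "f \<in> central_cone n \<Longrightarrow> (half_sum n ^^ k) f \<in> central_cone n"
  by (induction k) (auto intro: half_sum_in_central_cone)

lemma outweighs_half_sum: "outweighs n f g \<Longrightarrow> outweighs n (half_sum n f) (half_sum n g)"
  by (simp add: half_sum_eq outweighs_scale outweighs_nbr_sum del: times_divide_eq_left)

lemma parity_vec_in_central_cone: "odd n \<Longrightarrow> parity_vec n b \<in> central_cone n"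
  by (auto simp: central_cone_def parity_vec_def)

text \<open>
  A leaf attached to a vertex at an odd position always has two choices, so after halving it
  leaves no trace.
\<close>

lemma half_sum_parity_True:
  assumes "odd n"
  shows "half_sum n (parity_vec n True) = parity_vec n False"
proof
  fix i
  show "half_sum n (parity_vec n True) i = parity_vec n False i"
  proof (cases "i < n")
    case True
    then show ?thesis using assms
      by (cases "even i") (auto simp: half_sum_def nbr_sum_eq parity_vec_def, presburger+)
  next
    case False
    then show ?thesis by (simp add: half_sum_def nbr_sum_def path_arc_iff parity_vec_def)
  qed
qed

lemma half_sum_pow_parity:
  assumes "i < n"
  shows "(half_sum n ^^ k) (parity_vec n b) i = (if even (i + k) = b then (half_sum n ^^ k) (\<lambda>_. 1) i else 0)"
  using assms
proof (induction k arbitrary: i)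
  case 0
  then show ?case by (simp add: parity_vec_def)
next
  case (Suc k)
  have par: "even (j + k) = even (i + Suc k)" "j < n" if "(i, j) \<in> parcs (path_graph n)" for j
    using that by (auto simp: path_arc_iff)
  have "(half_sum n ^^ Suc k) (parity_vec n b) i =
      (\<Sum>j | (i, j) \<in> parcs (path_graph n). if even (i + Suc k) = b then (half_sum n ^^ k) (\<lambda>_. 1) j else 0) / 2"
    unfolding funpow.simps(2) comp_def half_sum_def[of n _ i] nbr_sum_def
    using Suc.IH par by (intro arg_cong2[of _ _ _ _ "(/)"] sum.cong) auto
  then show ?case by (simp add: half_sum_def[of n _ i] nbr_sum_def)
qed

lemma outweighs_walks_odd:
  assumes "odd n" "even k" "even l"
  shows "outweighs n (\<lambda>i. (half_sum n ^^ k) (parity_vec n b) i * (half_sum n ^^ l) (parity_vec n b) i)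
    ((half_sum n ^^ (k + l)) (parity_vec n b))"
  unfolding outweighs_def
proof
  fix r assume r: "r \<in> central_cone n"
  let ?w = "\<lambda>k. (half_sum n ^^ k) (parity_vec n b)"
  have cone: "?w l \<in> central_cone n"
    using assms(1) by (intro half_sum_pow_in_central_cone parity_vec_in_central_cone)
  have "dotp n r (?w (k + l)) = dotp n r ((half_sum n ^^ k) (?w l))" by (simp add: funpow_add)
  also have "\<dots> = (1 / 2) ^ k * dotp n r ((nbr_sum n ^^ k) (?w l))"
    by (simp add: half_sum_pow_eq[of k n] dotp_scale)
  also have "\<dots> \<le> (1 / 2) ^ k * dotp n (\<lambda>i. r i * ?w l i) ((nbr_sum n ^^ k) (\<lambda>_. 1))"
    using r cone assms by (intro mult_left_mono central_cone_dotp_le) auto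
  also have "\<dots> = dotp n (\<lambda>i. r i * ?w l i) ((half_sum n ^^ k) (\<lambda>_. 1))"
    by (simp add: half_sum_pow_eq[of k n] dotp_scale)
  also have "\<dots> = dotp n r (\<lambda>i. ?w k i * ?w l i)"
    unfolding dotp_def using assms(2,3)
    by (intro sum.cong) (auto simp: half_sum_pow_parity[of _ n k] half_sum_pow_parity[of _ n l])
  finally show "dotp n r (?w (k + l)) \<le> dotp n r (\<lambda>i. ?w k i * ?w l i)" .
qed

text \<open>
  The sum over all odd positions of the probability that a simple random walk, started there and
  killed when it leaves \<open>[n]\<close>, survives \<open>2 * j\<close> steps.
\<close>

definition even_walks :: "nat \<Rightarrow> nat \<Rightarrow> real" where
  "even_walks n j = dotp n (\<lambda>_. 1) ((half_sum n ^^ (2 * j)) (parity_vec n False))"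

lemma even_walks_eq_dotp:
  assumes "k + l = 2 * j"
  shows "even_walks n j = dotp n ((half_sum n ^^ k) (parity_vec n False)) ((half_sum n ^^ l) (parity_vec n False))"
proof -
  have "even_walks n j = dotp n (parity_vec n False) ((half_sum n ^^ (k + l)) (parity_vec n False))"
    unfolding even_walks_def dotp_def assms
    by (intro sum.cong) (auto simp: half_sum_pow_parity parity_vec_def)
  then show ?thesis by (simp add: half_sum_pow_self_adjoint funpow_add)
qed

text \<open>
  The second difference of the sequence is the squared norm of \<open>B\<^sup>j e - B\<^sup>j\<^sup>+\<^sup>2 e\<close>, where \<open>B\<close> is \<open>half_sum\<close>
  and \<open>e\<close> is the indicator of the odd positions.
\<close>

lemma even_walks_convex: "2 * even_walks n (Suc j) \<le> even_walks n j + even_walks n (Suc (Suc j))"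
proof -
  let ?w = "\<lambda>k. (half_sum n ^^ k) (parity_vec n False)"
  have "0 \<le> (\<Sum>i<n. (?w j i - ?w (j + 2) i)\<^sup>2)" by (intro sum_nonneg) simp
  also have "\<dots> = dotp n (?w j) (?w j) - 2 * dotp n (?w j) (?w (j + 2)) + dotp n (?w (j + 2)) (?w (j + 2))"
    unfolding dotp_def sum_distrib_left sum_subtractf[symmetric] sum.distrib[symmetric]
    by (intro sum.cong) (auto simp: power2_eq_square algebra_simps)
  finally show ?thesis
    using even_walks_eq_dotp[of j j j n] even_walks_eq_dotp[of j "j + 2" "Suc j" n]
      even_walks_eq_dotp[of "j + 2" "j + 2" "Suc (Suc j)" n] by simp
qed

lemma convex_balanced_le:
  fixes y :: "nat \<Rightarrow> real"
  assumes conv: "\<And>j. 2 * y (Suc j) \<le> y j + y (Suc (Suc j))"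
  shows "y ((a + b) div 2) + y ((a + b + 1) div 2) \<le> y a + y b"
proof -
  have diff: "y (Suc i) - y i \<le> y (Suc j) - y j" if "i \<le> j" for i j
    using that
  proof (induction j rule: dec_induct)
    case (step j)
    then show ?case using conv[of j] by simp
  qed simp
  have "y ((a + b) div 2) + y ((a + b + 1) div 2) \<le> y a + y b" if "a \<le> b" for a b
    using that
  proof (induction "b - a" arbitrary: a b rule: less_induct)
    case less
    show ?case
    proof (cases "b \<le> Suc a")
      case True
      then have "b = a \<or> b = Suc a" using less.prems by auto
      then show ?thesis by auto
    next
      case False
      then obtain c where c: "b = Suc c" "Suc a \<le> c" by (cases b) auto
      have "y ((Suc a + c) div 2) + y ((Suc a + c + 1) div 2) \<le> y (Suc a) + y c"
        using c by (intro less.hyps) auto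
      also have "\<dots> \<le> y a + y b" using diff[of a c] c by simp
      finally show ?thesis using c by simp
    qed
  qed
  from this[of a b] this[of b a] show ?thesis by (cases "a \<le> b") (auto simp: add_ac)
qed

lemma half_sum_pow_parity_True:
  assumes "odd n"
  shows "(half_sum n ^^ Suc k) (parity_vec n True) = (half_sum n ^^ k) (parity_vec n False)"
  by (simp only: funpow_Suc_right comp_def half_sum_parity_True[OF assms])

text \<open>
  After an even number of steps the walk is at an odd position again and cannot leave the path in
  the next step.
\<close>

lemma dotp_one_odd_walks:
  assumes "odd n"
  shows "dotp n (\<lambda>_. 1) ((half_sum n ^^ Suc (2 * j)) (parity_vec n False)) = even_walks n j"
proof -
  let ?w = "(half_sum n ^^ (2 * j)) (parity_vec n False)"
  have "dotp n (\<lambda>_. 1) ((half_sum n ^^ Suc (2 * j)) (parity_vec n False)) = dotp n (half_sum n (\<lambda>_. 1)) ?w"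
    using half_sum_pow_self_adjoint[of n 1 "\<lambda>_. 1" ?w] by simp
  also have "\<dots> = even_walks n j"
    unfolding even_walks_def dotp_def
  proof (intro sum.cong refl)
    fix i assume "i \<in> {..<n}"
    then show "half_sum n (\<lambda>_. 1) i * ?w i = 1 * ?w i"
      using assms by (cases "even i") (auto simp: half_sum_pow_parity half_sum_def nbr_sum_eq, presburger+)
  qed
  finally show ?thesis .
qed

lemma dotp_one_walks:
  assumes "odd n"
  shows "dotp n (\<lambda>_. 1) ((half_sum n ^^ k) (parity_vec n False)) = even_walks n (k div 2)"
proof (cases "even k")
  case True
  then show ?thesis by (simp add: even_walks_def)
next
  case False
  then obtain j where "k = Suc (2 * j)" by (auto elim: oddE)
  then show ?thesis using dotp_one_odd_walks[OF assms, of j] by simp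
qed

lemma hom_path_path_odd:
  assumes n: "odd n"
  shows "hom (path_graph (Suc (Suc k))) (path_graph n) =
    2 ^ Suc k * (even_walks n (k div 2) + even_walks n (Suc k div 2))"
proof -
  let ?B = "half_sum n" and ?one = "\<lambda>_. 1"
  have one: "dotp n ?one ((?B ^^ Suc k) ?one) =
      dotp n ?one ((?B ^^ Suc k) (parity_vec n True)) + dotp n ?one ((?B ^^ Suc k) (parity_vec n False))"
    unfolding dotp_def sum.distrib[symmetric]
    by (intro sum.cong refl) (simp add: half_sum_pow_parity del: funpow.simps)
  have "real (hom (path_graph (Suc (Suc k))) (path_graph n)) = 2 ^ Suc k * dotp n ?one ((?B ^^ Suc k) ?one)"
    unfolding hom_path_path half_sum_pow_eq dotp_scale by (simp add: power_one_over del: funpow.simps)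
  then show ?thesis
    unfolding one half_sum_pow_parity_True[OF n] dotp_one_walks[OF n] .
qed

lemma weighted_hom_parity:
  assumes "finite V"
  shows "weighted_hom n V R (\<lambda>v i. (1 / 2) * parity_vec n (col v) i) =
    (1 / 2) ^ card V * card {h \<in> path_homs n V R. \<forall>v\<in>V. even (h v) = col v}"
proof -
  have "(\<Prod>v\<in>V. (1 / 2) * parity_vec n (col v) (h v)) =
      (1 / 2) ^ card V * (if \<forall>v\<in>V. even (h v) = col v then 1 else 0)" if h: "h \<in> path_homs n V R" for h
  proof (cases "\<forall>v\<in>V. even (h v) = col v")
    case True
    then have "(\<Prod>v\<in>V. (1 / 2) * parity_vec n (col v) (h v)) = (\<Prod>v\<in>V. 1 / 2)"
      using h by (intro prod.cong) (auto simp: parity_vec_def path_homs_less)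
    then show ?thesis using True by simp
  next
    case False
    then show ?thesis using assms by (auto simp: parity_vec_def intro!: prod_zero)
  qed
  then show ?thesis
    unfolding weighted_hom_def
    by (simp add: sum_distrib_left[symmetric] sum.If_cases finite_path_homs assms Int_def)
qed

text \<open>
  Vertices of colour \<open>False\<close> go to odd positions, those of colour \<open>True\<close> to even positions. Let \<open>B\<close> be
  \<open>half_sum\<close> and consider a branch with \<open>s\<close> vertices of colour \<open>False\<close>. Twice its weight
  outweighs \<open>B\<close> to the power \<open>2 s\<close> applied to the indicator of the even positions if the root has colour
  \<open>True\<close>, and \<open>B\<close> to the power \<open>2 (s - 1)\<close> applied to the indicator of the odd positions if
  the root has colour \<open>False\<close>. Vertices of colour \<open>True\<close> do not enter, in accordance
  with \<open>half_sum_parity_True\<close>.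
\<close>

lemma leaf_grown_weighted_hom_parity_ge:
  assumes grown: "leaf_grown R P {x} V" and R: "sym R" "\<And>a. (a, a) \<notin> R" and n: "odd n"
    and col: "\<And>a b. a \<in> V \<Longrightarrow> b \<in> V \<Longrightarrow> (a, b) \<in> R \<Longrightarrow> col a \<noteq> (col b :: bool)"
    and R_V: "R \<subseteq> V \<times> V"
    and p: "p = card {v \<in> V. \<not> col v}" "1 \<le> p"
  shows "even_walks n (p - 1) \<le> 2 * weighted_hom n V R (\<lambda>v i. (1 / 2) * parity_vec n (col v) i)"
proof -
  \<comment> \<open>For a root of colour \<open>False\<close> the root itself is counted in \<open>s\<close>, hence \<open>s - 1\<close>.\<close>
  define K where "K b s = (half_sum n ^^ (2 * (if b then s else s - 1))) (parity_vec n b)" for b and s :: nat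
  define I where "I v f s \<longleftrightarrow> f \<in> central_cone n \<and> (col v \<or> 1 \<le> s) \<and>
    outweighs n (\<lambda>i. 2 * f i) (K (col v) s)" for v :: 'a and f s
  have K_cone: "K b s \<in> central_cone n" for b s
    unfolding K_def by (intro half_sum_pow_in_central_cone parity_vec_in_central_cone n)
  have fin: "finite V" using leaf_grown_finite[OF grown] by simp
  have "\<exists>f. I x f (\<Sum>v\<in>V. if col v then 0 else 1) \<and>
      weighted_hom n V R (\<lambda>v i. (1 / 2) * parity_vec n (col v) i) = (\<Sum>i<n. f i)"
  proof (rule leaf_grown_fold[OF grown R])
    fix u v f g s t assume vu: "(v, u) \<in> R" and "I v f s" "I u g t"
    then have f: "f \<in> central_cone n" "col v \<or> 1 \<le> s" "outweighs n (\<lambda>i. 2 * f i) (K (col v) s)"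
      and g: "g \<in> central_cone n" "col u \<or> 1 \<le> t" "outweighs n (\<lambda>i. 2 * g i) (K (col u) t)"
      by (auto simp: I_def)
    have cu: "col u = (\<not> col v)" using col vu R_V by blast
    have Ag: "half_sum n (\<lambda>i. 2 * g i) = nbr_sum n g"
      by (simp add: half_sum_eq nbr_sum_scale)
    define k where "k = 2 * (if col v then s else s - 1)"
    have step: "half_sum n (K (col u) t) = (half_sum n ^^ (2 * t)) (parity_vec n (col v))"
    proof (cases "col v")
      case True
      with cu g(2) obtain t' where "t = Suc t'" by (cases t) auto
      then show ?thesis
        using True cu half_sum_pow_parity_True[OF n, of "Suc (2 * t')"] by (simp add: K_def)
    next
      case False
      then show ?thesis
        using cu half_sum_pow_parity_True[OF n, of "2 * t"] by (simp add: K_def)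
    qed
    have "outweighs n (\<lambda>i. 2 * f i * nbr_sum n g i)
        (\<lambda>i. K (col v) s i * (half_sum n ^^ (2 * t)) (parity_vec n (col v)) i)"
      using f g outweighs_half_sum[OF g(3)] unfolding step Ag
      by (intro outweighs_mult half_sum_pow_in_central_cone parity_vec_in_central_cone n central_cone_scale) auto
    moreover have "outweighs n (\<lambda>i. K (col v) s i * (half_sum n ^^ (2 * t)) (parity_vec n (col v)) i)
        (K (col v) (s + t))"
    proof -
      have "K (col v) (s + t) = (half_sum n ^^ (k + 2 * t)) (parity_vec n (col v))"
        using f(2) by (auto simp: K_def k_def algebra_simps)
      then show ?thesis
        using outweighs_walks_odd[OF n, of k "2 * t" "col v"] by (simp add: K_def k_def)
    qed
    ultimately have "outweighs n (\<lambda>i. 2 * (f i * nbr_sum n g i)) (K (col v) (s + t))"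
      using outweighs_trans by (simp add: mult.assoc)
    then show "I v (\<lambda>i. f i * nbr_sum n g i) (s + t)"
      using f g by (auto simp: I_def intro!: central_cone_mult nbr_sum_in_central_cone)
  next
    fix v assume "v \<in> V"
    have "(\<lambda>i. 2 * ((1 / 2) * parity_vec n b i)) = parity_vec n b" for b
      by (simp add: fun_eq_iff)
    moreover have "(\<lambda>i. (1 / 2) * parity_vec n (col v) i) \<in> central_cone n"
      by (intro central_cone_scale parity_vec_in_central_cone n) simp
    ultimately show "I v (\<lambda>i. (1 / 2) * parity_vec n (col v) i) (if col v then 0 else 1)"
      unfolding I_def by (auto simp: K_def outweighs_refl)
  qed
  moreover have "(\<Sum>v\<in>V. if col v then 0 else 1 :: nat) = p"
    using fin by (simp add: p(1) sum.If_cases Int_def)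
  ultimately obtain f where f: "I x f p"
    "weighted_hom n V R (\<lambda>v i. (1 / 2) * parity_vec n (col v) i) = (\<Sum>i<n. f i)"
    by auto
  have "dotp n (\<lambda>_. 1) (K (col x) p) = even_walks n (p - 1)"
  proof (cases "col x")
    case True
    obtain p' where "p = Suc p'" using p(2) by (cases p) auto
    then show ?thesis
      using True half_sum_pow_parity_True[OF n, of "Suc (2 * p')"] dotp_one_odd_walks[OF n, of p']
      by (simp add: K_def)
  qed (simp add: K_def even_walks_def)
  moreover have "dotp n (\<lambda>_. 1) (K (col x) p) \<le> dotp n (\<lambda>_. 1) (\<lambda>i. 2 * f i)"
    using f(1) one_in_central_cone by (auto simp: I_def outweighs_def)
  ultimately show ?thesis
    unfolding f(2) by (simp add: dotp_def sum_distrib_left)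
qed

lemma leaf_grown_path_homs_ge_odd:
  assumes grown: "leaf_grown R P {x} V" and R: "sym R" "\<And>a. (a, a) \<notin> R" and n: "odd n"
    and R_V: "R \<subseteq> V \<times> V" and V: "card V = Suc (Suc k)"
  shows "2 ^ Suc k * (even_walks n (k div 2) + even_walks n (Suc k div 2)) \<le> card (path_homs n V R)"
proof -
  have fin: "finite V" using leaf_grown_finite[OF grown] by simp
  obtain col :: "'a \<Rightarrow> bool" where col: "\<And>a b. a \<in> V \<Longrightarrow> b \<in> V \<Longrightarrow> (a, b) \<in> R \<Longrightarrow> col a \<noteq> col b"
    using leaf_grown_coloring[OF grown R] by blast
  have "V \<noteq> {x}" using V by auto
  then obtain a b where ab: "a \<in> V" "b \<in> V" "col a" "\<not> col b"
    using leaf_grown_arc[OF grown] col by blast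
  define p q where "p = card {v \<in> V. \<not> col v}" and "q = card {v \<in> V. \<not> \<not> col v}"
  have pq: "1 \<le> p" "1 \<le> q"
    using ab fin by (auto simp: p_def q_def Suc_le_eq card_gt_0_iff)
  have "p + q = card ({v \<in> V. \<not> col v} \<union> {v \<in> V. \<not> \<not> col v})"
    unfolding p_def q_def using fin by (intro card_Un_disjoint[symmetric]) auto
  also have "{v \<in> V. \<not> col v} \<union> {v \<in> V. \<not> \<not> col v} = V" by auto
  finally have sum: "(p - 1) + (q - 1) = k" using pq V by simp
  let ?H = "\<lambda>c. {h \<in> path_homs n V R. \<forall>v\<in>V. even (h v) = c v}"
  have class_bound: "2 ^ Suc k * even_walks n (card {v \<in> V. \<not> c v} - 1) \<le> card (?H c)"
    if c: "\<And>a b. a \<in> V \<Longrightarrow> b \<in> V \<Longrightarrow> (a, b) \<in> R \<Longrightarrow> c a \<noteq> (c b :: bool)"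
      and "1 \<le> card {v \<in> V. \<not> c v}" for c
    using leaf_grown_weighted_hom_parity_ge[OF grown R n c R_V refl that(2)]
    unfolding weighted_hom_parity[OF fin] V by (simp add: power_one_over field_simps)
  have "2 ^ Suc k * (even_walks n (k div 2) + even_walks n (Suc k div 2)) \<le>
      2 ^ Suc k * (even_walks n (p - 1) + even_walks n (q - 1))"
    using convex_balanced_le[of "even_walks n" "p - 1" "q - 1", OF even_walks_convex] sum
    by (intro mult_left_mono) auto
  also have "\<dots> \<le> card (?H col) + card (?H (\<lambda>v. \<not> col v))"
    using class_bound[of col] class_bound[of "\<lambda>v. \<not> col v"] col pq
    unfolding p_def q_def by (simp add: distrib_left)
  also have "\<dots> = card (?H col \<union> ?H (\<lambda>v. \<not> col v))"
    using ab(1) finite_path_homs[OF fin] by (subst card_Un_disjoint) auto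
  also have "\<dots> \<le> card (path_homs n V R)"
    using finite_path_homs[OF fin] by (intro of_nat_mono card_mono) auto
  finally show ?thesis .
qed

section \<open>KC-transformations of trees\<close>

text \<open>
  If \<open>F0\<close> numbers the vertices of a path from \<open>0\<close> at \<open>x\<close> up to its length at \<open>y\<close>, then \<open>F\<close> decreases
  along the branches at \<open>x\<close> and increases along those at \<open>y\<close>. Its variation is therefore the length of
  a longest path through \<open>x\<close> and \<open>y\<close>. The sign of \<open>F v\<close> tells on which side \<open>v\<close> lies.
\<close>

lemma leaf_grown_potential:
  fixes F0 :: "'a \<Rightarrow> int"
  assumes "leaf_grown R P S V" and R: "sym R" "\<And>a. (a, a) \<notin> R"
    and F0: "\<And>a b. a \<in> S \<Longrightarrow> b \<in> S \<Longrightarrow> (a, b) \<in> R \<Longrightarrow> F0 b \<le> F0 a + 1"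
  shows "\<exists>F. (\<forall>a\<in>S. F a = F0 a) \<and> (\<forall>a\<in>V. \<forall>b\<in>V. (a, b) \<in> R \<longrightarrow> F b \<le> F a + 1) \<and>
    leaf_grown R (\<lambda>u v. F u = (if F v \<le> 0 then F v - 1 else F v + 1)) S V"
  using assms(1)
proof (induction rule: leaf_grown.induct)
  case base
  show ?case using F0 by (intro exI[of _ F0]) (auto intro: leaf_grown.base)
next
  case (leaf V v u)
  then obtain F where F: "\<And>a. a \<in> S \<Longrightarrow> F a = F0 a"
      "\<And>a b. a \<in> V \<Longrightarrow> b \<in> V \<Longrightarrow> (a, b) \<in> R \<Longrightarrow> F b \<le> F a + 1"
      "leaf_grown R (\<lambda>u v. F u = (if F v \<le> 0 then F v - 1 else F v + 1)) S V"
    by blast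
  define G where "G = F(u := if F v \<le> 0 then F v - 1 else F v + 1)"
  have G: "G a = F a" if "a \<in> V" for a using that leaf.hyps(3) by (auto simp: G_def)
  have Gu: "G u = (if G v \<le> 0 then G v - 1 else G v + 1)" using leaf.hyps(2,3) by (auto simp: G_def)
  have out: "(u, w) \<notin> R" if "w \<in> V" "w \<noteq> v" for w
    using leaf.hyps(5)[OF that] symD[OF R(1)] by blast
  have "leaf_grown R (\<lambda>u v. G u = (if G v \<le> 0 then G v - 1 else G v + 1)) S V"
    using F(3) by (rule leaf_grown_mono) (use G in auto)
  then have "leaf_grown R (\<lambda>u v. G u = (if G v \<le> 0 then G v - 1 else G v + 1)) S (insert u V)"
    using leaf.hyps(2-5) Gu by (rule leaf_grown.leaf)
  moreover have "G b \<le> G a + 1" if "a \<in> insert u V" "b \<in> insert u V" "(a, b) \<in> R" for a b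
  proof -
    have Guv: "G v \<le> G u + 1" "G u \<le> G v + 1" by (simp_all add: Gu)
    consider "a = u" "b = u" | "a = u" "b \<in> V" | "a \<in> V" "b = u" | "a \<in> V" "b \<in> V"
      using \<open>a \<in> insert u V\<close> \<open>b \<in> insert u V\<close> by blast
    then show ?thesis
    proof cases
      case 1
      then show ?thesis by simp
    next
      case 2
      then have "b = v" using out \<open>(a, b) \<in> R\<close> by blast
      then show ?thesis using 2 Guv by simp
    next
      case 3
      then have "a = v" using leaf.hyps(5) \<open>(a, b) \<in> R\<close> by blast
      then show ?thesis using 3 Guv by simp
    next
      case 4
      then show ?thesis using F(2)[OF _ _ \<open>(a, b) \<in> R\<close>] G by simp
    qed
  qed
  moreover have "\<forall>a\<in>S. G a = F0 a"
    using F(1) G leaf_grown_subset[OF leaf.hyps(1)] by auto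
  ultimately show ?case by blast
qed

lemma pawalk_verts_nth:
  assumes "pcas u p v"
  shows "length (pawalk_verts u p) = Suc (length p)" "pawalk_verts u p ! 0 = u"
    "pawalk_verts u p ! length p = v"
    "\<And>i. i < length p \<Longrightarrow> p ! i = (pawalk_verts u p ! i, pawalk_verts u p ! Suc i)"
proof -
  have "length (pawalk_verts u p) = Suc (length p) \<and> pawalk_verts u p ! 0 = u \<and>
    pawalk_verts u p ! length p = v \<and>
    (\<forall>i < length p. p ! i = (pawalk_verts u p ! i, pawalk_verts u p ! Suc i))"
    using assms
  proof (induction p arbitrary: u)
    case (Cons e p)
    then have e: "fst e = u" "pcas (snd e) p v" by auto
    have "(e # p) ! i = (pawalk_verts u (e # p) ! i, pawalk_verts u (e # p) ! Suc i)"
      if "i < length (e # p)" for i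
      using that Cons.IH[OF e(2)] e(1) by (cases i; cases e) auto
    then show ?case using Cons.IH[OF e(2)] e(1) by auto
  qed simp
  then show "length (pawalk_verts u p) = Suc (length p)" "pawalk_verts u p ! 0 = u"
    "pawalk_verts u p ! length p = v"
    "\<And>i. i < length p \<Longrightarrow> p ! i = (pawalk_verts u p ! i, pawalk_verts u p ! Suc i)"
    by blast+
qed

text \<open>
  A tree with a path along which a KC-transformation can be performed; its vertices, in order,
  are \<open>vs\<close>.
\<close>

locale kc_path = undirected_tree_graph G for G :: "'a pair_pre_digraph" +
  fixes x y :: 'a and p :: "('a \<times> 'a) awalk"
  assumes xy: "x \<noteq> y"
    and apath: "pre_digraph.apath (with_proj G) x p y"
    and interior_degree: "\<And>v. v \<in> set (pre_digraph.awalk_verts (with_proj G) x p) - {x, y} \<Longrightarrow>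
      out_degree (with_proj G) v = 2"
begin

abbreviation "vs \<equiv> pawalk_verts x p"
abbreviation "len \<equiv> length p"
abbreviation "pvs \<equiv> (\<lambda>i. vs ! i) ` {..len}"

lemma awalk_p: "awalk x p y" "distinct vs" "pcas x p y"
  using apath by (auto simp: apath_def awalk_def)

lemmas vs_nth = pawalk_verts_nth[OF awalk_p(3)]

lemma set_vs: "set vs = pvs"
  using vs_nth(1) by (auto simp: in_set_conv_nth less_Suc_eq_le)

lemma len_pos: "0 < len"
  using awalk_p(3) xy by (cases p) auto

lemma vs_eq_iff: "i \<le> len \<Longrightarrow> j \<le> len \<Longrightarrow> vs ! i = vs ! j \<longleftrightarrow> i = j"
  using awalk_p(2) vs_nth(1) by (simp add: nth_eq_iff_index_eq)

lemma vs_arc: "i < len \<Longrightarrow> (vs ! i, vs ! Suc i) \<in> parcs G"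
  using awalk_p(1) vs_nth(4)[of i] nth_mem[of i p] by (auto simp: awalk_def)

lemma vs_in_pverts: "i \<le> len \<Longrightarrow> vs ! i \<in> pverts G"
  using awalk_verts_in_verts[of x p y] awalk_p vs_nth(1)
  by (metis awalk_def awalkE less_Suc_eq_le nth_mem subsetD awalk_hd_in_verts)

lemma connected_within_prefix: "i \<le> len \<Longrightarrow> connected_within (parcs G) ((\<lambda>i. vs ! i) ` {..i})"
proof (induction i)
  case 0
  then show ?case by (simp add: connected_within_singleton)
next
  case (Suc i)
  then show ?case
    using connected_within_insert[OF sym_parcs Suc.IH, of "vs ! i" "vs ! Suc i"] vs_arc[of i]
    by (simp add: atMost_Suc)
qed

text \<open>
  The path is induced: a chord would give one of its vertices a second neighbour in the
  connected set of its predecessors.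
\<close>

lemma vs_arc_iff:
  assumes "i \<le> len" "j \<le> len"
  shows "(vs ! i, vs ! j) \<in> parcs G \<longleftrightarrow> j = Suc i \<or> i = Suc j"
proof -
  have forward: "j = Suc i" if ij: "i < j" "j \<le> len" "(vs ! i, vs ! j) \<in> parcs G" for i j
  proof -
    obtain l where l: "j = Suc l" using ij(1) by (cases j) auto
    have "vs ! i = vs ! l"
    proof (rule unique_neighbor)
      show "connected_within (parcs G) ((\<lambda>i. vs ! i) ` {..l})" using l ij by (intro connected_within_prefix) auto
      show "(\<lambda>i. vs ! i) ` {..l} \<subseteq> pverts G" using l ij vs_in_pverts by auto
      show "(vs ! l, vs ! j) \<in> parcs G" using l ij vs_arc by auto
      show "vs ! j \<notin> (\<lambda>i. vs ! i) ` {..l}" using l ij by (auto simp: vs_eq_iff)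
    qed (use l ij in auto)
    then show ?thesis using l ij vs_eq_iff[of i l] by auto
  qed
  have "i \<noteq> j" if "(vs ! i, vs ! j) \<in> parcs G" using that irrefl_parcs by auto
  then show ?thesis
    using forward[of i j] forward[of j i] assms vs_arc[of i] vs_arc[of j] sym_parcs
    by (auto simp: Suc_le_eq dest: symD) (metis linorder_neqE_nat symD)+
qed

lemma interior_neighbor:
  assumes "u \<notin> pvs" "v \<in> pvs" "(v, u) \<in> parcs G"
  shows "v = x \<or> v = y"
proof (rule ccontr)
  assume v: "\<not> (v = x \<or> v = y)"
  obtain i where i: "v = vs ! i" "i \<le> len" using assms(2) by auto
  have "i \<noteq> 0" "i \<noteq> len" using v i vs_nth(2,3) by metis+
  then have i': "0 < i" "i < len" using i(2) by auto
  have deg: "card (out_arcs (with_proj G) v) = 2"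
    using interior_degree[of v] v assms(2) set_vs by (simp add: out_degree_def)
  let ?a = "(v, vs ! (i - 1))" and ?b = "(v, vs ! Suc i)"
  have sub: "{?a, ?b, (v, u)} \<subseteq> out_arcs (with_proj G) v"
    using i i' assms(3) vs_arc_iff[of i "i - 1"] vs_arc_iff[of i "Suc i"] by (auto simp: out_arcs_def)
  have "vs ! (i - 1) \<noteq> vs ! Suc i"
    using i' vs_eq_iff[of "i - 1" "Suc i"] by simp
  moreover have "vs ! (i - 1) \<in> pvs" "vs ! Suc i \<in> pvs" using i' by (auto intro: imageI)
  ultimately have "card {?a, ?b, (v, u)} = 3"
    using assms(1) by (auto simp: card_insert_if)
  moreover have "finite (out_arcs (with_proj G) v)"
    using deg card.infinite by fastforce
  ultimately show False using sub deg card_mono[of "out_arcs (with_proj G) v" "{?a, ?b, (v, u)}"] by simp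
qed

abbreviation "moved \<equiv> neighbors G y - {vs ! (len - 1)}"

lemma moved_disjoint: "moved \<inter> pvs = {}"
proof -
  have "j = len - 1" if "j \<le> len" "(y, vs ! j) \<in> parcs G" for j
    using vs_arc_iff[of len j] that vs_nth(3) by auto
  then show ?thesis by (auto simp: neighbors_def)
qed

lemma x_in_pvs: "x \<in> pvs" and y_in_pvs: "y \<in> pvs" and z_in_pvs: "vs ! (len - 1) \<in> pvs"
  using vs_nth(2,3) by force+

lemma parcs_KC:
  "parcs (KC G x p y) = (parcs G - ({y} \<times> moved \<union> moved \<times> {y})) \<union> ({x} \<times> moved \<union> moved \<times> {x})"
proof -
  have "fst (last p) = vs ! (len - 1)"
    using len_pos vs_nth(4)[of "len - 1"] by (cases p rule: rev_cases) (auto simp: last_conv_nth)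
  then show ?thesis by (simp add: KC_def Let_def)
qed

lemma pverts_KC: "pverts (KC G x p y) = pverts G"
  by (simp add: KC_def Let_def)

text \<open>
  A vertex outside the path that is adjacent to \<open>y\<close> becomes adjacent to \<open>x\<close> instead, and the
  arcs inside the path stay as they are. The degree condition on the interior ensures that all
  other branches hang at \<open>x\<close> or at \<open>y\<close>.
\<close>

lemma hom_KC_ge:
  assumes grown: "leaf_grown (parcs G) P pvs (pverts G)"
    and one: "\<And>v. (\<lambda>_. 1) \<in> C v"
    and mult: "\<And>v f g. f \<in> C v \<Longrightarrow> g \<in> C v \<Longrightarrow> (\<lambda>i. f i * g i) \<in> C v"
    and step: "\<And>u v f. P u v \<Longrightarrow> f \<in> C u \<Longrightarrow> nbr_sum n f \<in> C v"
    and main: "\<And>a b. a \<in> C x \<Longrightarrow> b \<in> C y \<Longrightarrow>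
      dotp n a ((nbr_sum n ^^ len) b) \<le> dotp n (\<lambda>i. a i * b i) ((nbr_sum n ^^ len) (\<lambda>_. 1))"
  shows "hom G (path_graph n) \<le> hom (KC G x p y) (path_graph n)"
proof -
  let ?R = "parcs G" and ?R' = "parcs (KC G x p y)" and ?V = "pverts G"
  have on_path: "weighted_hom n pvs ?R \<phi> = dotp n (\<phi> x) ((nbr_sum n ^^ len) (\<phi> y))"
    if "\<And>v. v \<in> pvs - {x, y} \<Longrightarrow> \<phi> v = (\<lambda>_. 1)" for \<phi> :: "'a \<Rightarrow> nat \<Rightarrow> real"
  proof -
    let ?\<psi> = "\<phi>(y := \<lambda>_. 1)"
    have "weighted_hom n pvs ?R (?\<psi>(vs ! len := \<lambda>i. ?\<psi> (vs ! len) i * \<phi> y i)) =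
        dotp n (?\<psi> (vs ! 0)) ((nbr_sum n ^^ len) (\<phi> y))"
    proof (rule weighted_hom_path[OF sym_parcs irrefl_parcs])
      show "inj_on (\<lambda>i. vs ! i) {..len}" by (auto simp: inj_on_def vs_eq_iff)
      show "(vs ! i, vs ! j) \<in> ?R \<longleftrightarrow> j = Suc i \<or> i = Suc j" if "i \<le> len" "j \<le> len" for i j
        using that by (rule vs_arc_iff)
      show "?\<psi> (vs ! i) = (\<lambda>_. 1)" if "0 < i" "i \<le> len" for i
        using that(1) that(2) \<open>\<And>v. v \<in> pvs - {x, y} \<Longrightarrow> \<phi> v = (\<lambda>_. 1)\<close>[of "vs ! i"]
          vs_eq_iff[of i 0] vs_nth(2) by auto
    qed
    moreover have "?\<psi>(vs ! len := \<lambda>i. ?\<psi> (vs ! len) i * \<phi> y i) = \<phi>"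
      using vs_nth(3) by (auto simp: fun_eq_iff)
    moreover have "?\<psi> (vs ! 0) = \<phi> x" using vs_nth(2) xy by simp
    ultimately show ?thesis by simp
  qed
  have le: "weighted_hom n ?V ?R (\<lambda>_ _. 1) \<le>
      weighted_hom n ?V ?R' ((\<lambda>_ _. 1)(x := \<lambda>i. 1 * 1, y := \<lambda>_. 1))"
  proof (rule weighted_hom_kc_le[where C = C and \<phi> = "\<lambda>_ _. 1", OF grown _ sym_parcs irrefl_parcs])
    show "sym ?R'" using sym_parcs unfolding parcs_KC by (auto simp: sym_def)
    show "(a, a) \<notin> ?R'" for a
      using irrefl_parcs moved_disjoint x_in_pvs unfolding parcs_KC by auto
    show "(a, b) \<in> ?R \<longleftrightarrow> (a, b) \<in> ?R'" if "a \<in> pvs" "b \<in> pvs" for a b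
      using that moved_disjoint unfolding parcs_KC by blast
    show "(w, u) \<in> ?R' \<longleftrightarrow> ((w, u) \<in> ?R \<and> w \<noteq> y) \<or> (w = x \<and> (y, u) \<in> ?R)" if "u \<notin> pvs" for w u
    proof -
      have "u \<noteq> x" "u \<noteq> y" "u \<noteq> vs ! (len - 1)"
        using that x_in_pvs y_in_pvs z_in_pvs by auto
      then show ?thesis unfolding parcs_KC neighbors_def by auto
    qed
    show "v = x \<or> v = y" if "u \<notin> pvs" "v \<in> pvs" "(v, u) \<in> ?R" for u v
      using that by (rule interior_neighbor)
    show "weighted_hom n pvs ?R \<phi> \<le> weighted_hom n pvs ?R (\<phi>(x := \<lambda>i. \<phi> x i * \<phi> y i, y := \<lambda>_. 1))"
      if "\<phi> x \<in> C x" "\<phi> y \<in> C y" "\<And>v. v \<in> pvs - {x, y} \<Longrightarrow> \<phi> v = (\<lambda>_. 1)" for \<phi>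
      using main[OF that(1,2)] on_path[of \<phi>] that(3) xy
        on_path[of "\<phi>(x := \<lambda>i. \<phi> x i * \<phi> y i, y := \<lambda>_. 1)"] by simp
  qed (use xy x_in_pvs y_in_pvs one mult step in auto)
  have ones: "(\<lambda>_ _. 1 :: real)(x := \<lambda>i. 1 * 1, y := \<lambda>_. 1) = (\<lambda>_ _. 1)"
    by (auto simp: fun_eq_iff)
  have "?R' \<subseteq> ?V \<times> ?V"
    using parcs_subset vs_in_pverts vs_nth(2) unfolding parcs_KC neighbors_def by fastforce
  then show ?thesis
    using le parcs_subset unfolding ones
    by (simp add: weighted_hom_one hom_path_graph_eq pverts_KC)
qed

lemma leaf_grown_path: "leaf_grown (parcs G) (\<lambda>_ _. True) pvs (pverts G)"
  using connected_within_prefix[of len] vs_in_pverts by (intro leaf_grown_from) auto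

lemma hom_KC_ge_even:
  assumes "even n"
  shows "hom G (path_graph n) \<le> hom (KC G x p y) (path_graph n)"
  using assms
  by (intro hom_KC_ge[OF leaf_grown_path, of "\<lambda>_. central_cone n"] one_in_central_cone
      central_cone_mult nbr_sum_in_central_cone central_cone_dotp_le) auto

text \<open>
  The height of a vertex is measured by how far the potential can still move away from the path, so it
  drops whenever a leaf is attached. The heights of \<open>x\<close> and \<open>y\<close> and the length of the path
  add up to the total variation of the potential, which the diameter bounds.
\<close>

lemma hom_KC_ge_diam:
  assumes diam: "diam G \<le> ereal (real n - 1)"
  shows "hom G (path_graph n) \<le> hom (KC G x p y) (path_graph n)"
proof -
  let ?V = "pverts G" and ?R = "parcs G"
  define F0 where "F0 a = int (inv_into {..len} (\<lambda>i. vs ! i) a)" for a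
  have inj: "inj_on (\<lambda>i. vs ! i) {..len}" by (auto simp: inj_on_def vs_eq_iff)
  have F0: "F0 (vs ! i) = int i" if "i \<le> len" for i
    using that inj by (simp add: F0_def)
  have "F0 b \<le> F0 a + 1" if "a \<in> pvs" "b \<in> pvs" "(a, b) \<in> ?R" for a b
    using that by (auto simp: F0 vs_arc_iff)
  then obtain F where F: "\<And>a. a \<in> pvs \<Longrightarrow> F a = F0 a"
      "\<And>a b. a \<in> ?V \<Longrightarrow> b \<in> ?V \<Longrightarrow> (a, b) \<in> ?R \<Longrightarrow> F b \<le> F a + 1"
      "leaf_grown ?R (\<lambda>u v. F u = (if F v \<le> 0 then F v - 1 else F v + 1)) pvs ?V"
    using leaf_grown_potential[OF leaf_grown_path sym_parcs irrefl_parcs, of F0] by blast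
  have Fx: "F x = 0" and Fy: "F y = int len"
    using F(1) F0[of 0] F0[of len] x_in_pvs y_in_pvs vs_nth(2,3) by simp_all
  define lo hi where "lo = Min (F ` ?V)" and "hi = Max (F ` ?V)"
  have bounds: "lo \<le> F v" "F v \<le> hi" if "v \<in> ?V" for v
    using that pair_finite_verts by (auto simp: lo_def hi_def)
  have xyV: "x \<in> ?V" "y \<in> ?V" using vs_in_pverts[of 0] vs_in_pverts[of len] vs_nth(2,3) by auto
  have "lo \<in> F ` ?V" "hi \<in> F ` ?V"
    unfolding lo_def hi_def using xyV pair_finite_verts by (auto intro!: Min_in Max_in)
  then obtain a b where ab: "a \<in> ?V" "b \<in> ?V" "F a = lo" "F b = hi" by auto
  have "F d \<le> F c + 1" if "(c, d) \<in> ?R" for c d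
    using F(2) that parcs_subset by blast
  then have "ereal (of_int (hi - lo)) \<le> graph_dist G a b"
    using potential_diff_le_dist[where F = F and a = a and b = b] ab by simp
  also have "\<dots> \<le> ereal (real n - 1)"
    using graph_dist_le_diam[OF ab(1,2)] diam by (rule order_trans)
  finally have spread: "hi - lo + 1 \<le> int n" by simp
  define height where "height v = nat (if F v \<le> 0 then F v - lo else hi - F v)" for v
  define C where "C v = rising_cone n (height v)" for v
  have grown: "leaf_grown ?R (\<lambda>u v. height u < height v) pvs ?V"
    using F(3)
  proof (rule leaf_grown_mono)
    fix u v assume "u \<in> ?V - pvs" "F u = (if F v \<le> 0 then F v - 1 else F v + 1)"
    then show "height u < height v"
      using bounds[of u] by (auto simp: height_def split: if_splits)
  qed
  have heights: "height x + height y + len + 1 \<le> n"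
    using bounds[OF xyV(1)] bounds[OF xyV(2)] spread len_pos by (auto simp: height_def Fx Fy)
  show ?thesis
  proof (rule hom_KC_ge[OF grown, of C])
    fix u v f assume "height u < height v" "f \<in> C u"
    then show "nbr_sum n f \<in> C v" unfolding C_def using nbr_sum_in_rising_cone by blast
  next
    fix a b assume "a \<in> C x" "b \<in> C y"
    then show "dotp n a ((nbr_sum n ^^ len) b) \<le> dotp n (\<lambda>i. a i * b i) ((nbr_sum n ^^ len) (\<lambda>_. 1))"
      unfolding C_def by (rule rising_cone_dotp_le[OF _ _ heights len_pos])
  qed (simp_all only: C_def one_in_rising_cone rising_cone_mult)
qed

end

section \<open>Homomorphisms from trees to paths\<close>

lemma undirected_tree_graphI:
  assumes "undirected_tree T"
  shows "undirected_tree_graph T"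
  using assms unfolding undirected_tree_def undirected_tree_graph_def undirected_tree_graph_axioms_def
  by blast

lemma hom_KC_transformation_ge:
  assumes "undirected_tree T" "KC_transformation T T'" "even n \<or> diam T \<le> ereal (real n - 1)"
  shows "hom T (path_graph n) \<le> hom T' (path_graph n)"
proof -
  interpret undirected_tree_graph T using assms(1) by (rule undirected_tree_graphI)
  from assms(2) obtain x y p where kc: "x \<noteq> y" "pre_digraph.apath (with_proj T) x p y"
    "\<forall>v \<in> set (pre_digraph.awalk_verts (with_proj T) x p) - {x, y}. out_degree (with_proj T) v = 2"
    and T': "T' = KC T x p y"
    unfolding KC_transformation_def by blast
  interpret kc_path T x y p by unfold_locales (use kc in blast)+
  show ?thesis unfolding T' using assms(3) hom_KC_ge_even hom_KC_ge_diam by blast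
qed

context undirected_tree_graph
begin

lemma leaf_grown_vertex:
  assumes "x \<in> pverts G"
  shows "leaf_grown (parcs G) (\<lambda>_ _. True) {x} (pverts G)"
  using assms connected_within_singleton[of "parcs G" x] by (intro leaf_grown_from) auto

lemma hom_eq: "hom G (path_graph n) = card (path_homs n (pverts G) (parcs G))"
  by (rule hom_path_graph_eq[OF parcs_subset])

lemma hom_path_le: "hom (path_graph (card (pverts G))) (path_graph n) \<le> hom G (path_graph n)"
proof -
  let ?V = "pverts G"
  obtain x where x: "x \<in> ?V" using pverts_nonempty by blast
  note grown = leaf_grown_vertex[OF x]
  have "real (hom (path_graph (card ?V)) (path_graph n)) \<le> real (card (path_homs n ?V (parcs G)))"
  proof (cases "even n")
    case True
    have "card ?V = Suc (card ?V - 1)" using x pair_finite_verts card_gt_0_iff[of ?V] by auto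
    then have "real (hom (path_graph (card ?V)) (path_graph n)) =
        dotp n (\<lambda>_. 1) ((nbr_sum n ^^ (card ?V - 1)) (\<lambda>_. 1))"
      using hom_path_path[of "card ?V - 1" n] by simp
    then show ?thesis
      using leaf_grown_path_homs_ge_even[OF grown sym_parcs irrefl_parcs True] by simp
  next
    case False
    consider "card ?V = 1" | k where "card ?V = Suc (Suc k)"
      using x pair_finite_verts card_gt_0_iff[of ?V]
      by (metis One_nat_def Suc_pred empty_iff old.nat.exhaust)
    then show ?thesis
    proof cases
      case 1
      then have "?V = {x}" using x by (auto simp: card_1_singleton_iff)
      then have "real (card (path_homs n ?V (parcs G))) = n"
        using weighted_hom_singleton[of x "parcs G" n "\<lambda>_ _. 1"] irrefl_parcs
        by (simp add: weighted_hom_one)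
      then show ?thesis using 1 hom_path_path[of 0 n] by (simp add: dotp_def)
    next
      case 2
      then show ?thesis
        using leaf_grown_path_homs_ge_odd[OF grown sym_parcs irrefl_parcs False parcs_subset 2]
          hom_path_path_odd[OF False, of k] by simp
    qed
  qed
  then show ?thesis by (simp add: hom_eq)
qed

lemma hom_le_star: "hom G (path_graph n) \<le> hom (star_graph (card (pverts G))) (path_graph n)"
proof -
  let ?V = "pverts G"
  obtain x where x: "x \<in> ?V" using pverts_nonempty by blast
  note grown = leaf_grown_vertex[OF x]
  obtain k where k: "card ?V = Suc k"
    using x pair_finite_verts card_gt_0_iff[of ?V] by (cases "card ?V") auto
  show ?thesis
  proof (cases "2 \<le> n")
    case True
    then show ?thesis
      using leaf_grown_card_path_homs_le[OF grown sym_parcs irrefl_parcs True]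
        hom_star_path_eq[OF True, of k] by (simp add: hom_eq k)
  next
    case False
    then have n: "n \<le> 1" by simp
    show ?thesis
    proof (cases "?V = {x}")
      case True
      have "real (card (path_homs n ?V (parcs G))) = n"
        using weighted_hom_singleton[of x "parcs G" n "\<lambda>_ _. 1"] irrefl_parcs True
        by (simp add: weighted_hom_one)
      then show ?thesis using True hom_star_path[of 0 n] by (simp add: hom_eq)
    next
      case False
      then obtain a b where "a \<in> ?V" "b \<in> ?V" "(a, b) \<in> parcs G"
        using leaf_grown_arc[OF grown] by blast
      then have "path_homs n ?V (parcs G) = {}"
        using n path_homs_arc[of _ n ?V "parcs G" a b] by (fastforce simp: path_arc_iff)
      then show ?thesis by (simp add: hom_eq)
    qed
  qed
qed

end

theorem theorem1p4:
  fixes T :: "'a pair_pre_digraph" and m n :: nat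
  assumes "m \<ge> 1" and "n \<ge> 1"
    and "undirected_tree T" and "card (pverts T) = m"
  shows "(\<forall>T'. KC_transformation T T' \<longrightarrow>
             even n \<or> (odd n \<and> diam T \<le> ereal (real n - 1)) \<longrightarrow>
             hom T (path_graph n) \<le> hom T' (path_graph n)) \<and>
         hom (path_graph m) (path_graph n) \<le> hom T (path_graph n) \<and>
         hom T (path_graph n) \<le> hom (star_graph m) (path_graph n)"
proof -
  interpret undirected_tree_graph T using assms(3) by (rule undirected_tree_graphI)
  show ?thesis
    using hom_KC_transformation_ge[OF assms(3)] hom_path_le hom_le_star assms(4) by blast
qed

end
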